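(* Let $\mathcal A$ be a unital C$^*$-algebra and $x_1,\ldots,x_n$ self-adjoint elements of $\mathcal A$. Then $\delta_{top}(x_1,\ldots,x_n)\le\max\{\mathfrak K_{top}^{(2)}(x_1,\ldots,x_n),1\}$. In particular, if $\mathfrak K_{top}^{(2)}(x_1,\ldots,x_n)=0$ then $\delta_{top}(x_1,\ldots,x_n)\le1$.
   Context: Microstates. Let $\mathcal A$ be a unital C$^*$-algebra and $x_1,\dots,x_n,y_1,\dots,y_m$ self-adjoint elements of $\mathcal A$. Let $\{P_r\}_{r\ge1}$ enumerate all noncommutative polynomials in the indeterminates $X_1,\dots,X_n,Y_1,\dots,Y_m$ whose coefficients have rational real and imaginary parts (constants allowed). $\mathcal M_k^{s.a.}(\mathbb C)$ is the set of self-adjoint $k\times k$ complex matrices and $\tau_k=\frac1k\mathrm{Tr}$. For $R,\epsilon>0$ and $r,k\in\mathbb N$, $\Gamma_R^{(top)}(x_1,\dots,x_n:y_1,\dots,y_m;k,\epsilon,P_1,\dots,P_r)$ is the set of $(A_1,\dots,A_n)\in\mathcal M_k^{s.a.}(\mathbb C)^n$ for which there exist $B_1,\dots,B_m\in\mathcal M_k^{s.a.}(\mathbb C)$ with $\max_{i,j}\{\|A_i\|,\|B_j\|\}\le R$ and $\big|\|P_j(A_1,\dots,A_n,B_1,\dots,B_m)\|-\|P_j(x_1,\dots,x_n,y_1,\dots,y_m)\|\big|\le\epsilon$ for $1\le j\le r$. When $m=0$ it is written $\Gamma_R^{(top)}(x_1,\dots,x_n;k,\epsilon,P_1,\dots,P_r)$.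 Covering numbers. On $\mathcal M_k(\mathbb C)^n$ put $\|(A_i)\|=\max_i\|A_i\|$ (operator norm) and $\|(A_i)\|_2=(\sum_i\tau_k(A_i^*A_i))^{1/2}$. For $\Sigma\subseteq\mathcal M_k(\mathbb C)^n$, $\nu_\infty(\Sigma,\omega)$ is the minimal number of open $\|\cdot\|$-balls of radius $\omega$ centred at points of $\Sigma$ covering $\Sigma$. The $\omega$-orbit ball centred at $(B_i)$ is the set of $(A_i)$ such that some unitary $W\in\mathcal M_k(\mathbb C)$ satisfies $\|(A_i)-(WB_iW^* )\|_2<\omega$; $o_2(\Sigma,\omega)$ is the minimal number of $\omega$-orbit balls centred at points of $\Sigma$ covering $\Sigma$. Convention $\log 0=-\infty$. Topological free entropy dimension: $\delta_{top}(x:y)=\limsup_{\omega\to0^+}\sup_{R>0}\inf_{\epsilon>0,r\in\mathbb N}\limsup_{k\to\infty}\frac{\log\nu_\infty(\Gamma_R^{(top)}(x:y;k,\epsilon,P_1,\dots,P_r),\omega)}{-k^2\log\omega}$. Topological orbit dimension: $\mathfrak K^{(2)}_{top}(x:y;\omega)=\sup_{R>0}\inf_{\epsilon>0,r\in\mathbb N}\limsup_{k\to\infty}\frac{\log o_2(\Gamma_R^{(top)}(x:y;k,\epsilon,P_1,\dots,P_r),\omega)}{k^2}$ and $\mathfrak K_{top}^{(2)}(x:y)=\limsup_{\omega\to0^+}\mathfrak K_{top}^{(2)}(x:y;\omega)$. When $m=0$ the "$:y$" part is omitted. *)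

theory Defs
  imports "HOL-Analysis.Analysis" "HOL-Library.Extended_Nat" "HOL-Library.Liminf_Limsup"
          "Jordan_Normal_Form.Matrix"
begin

locale unital_cstar =
  fixes sc :: "complex \<Rightarrow> 'a::{real_normed_algebra_1,banach} \<Rightarrow> 'a"
    and st :: "'a \<Rightarrow> 'a"
  assumes sc_add_right: "sc c (x + y) = sc c x + sc c y"
    and sc_add_left: "sc (c + d) x = sc c x + sc d x"
    and sc_assoc: "sc c (sc d x) = sc (c * d) x"
    and sc_one: "sc 1 x = x"
    and sc_real: "sc (complex_of_real r) x = scaleR r x"
    and sc_mult_left: "sc c (x * y) = sc c x * y"
    and sc_mult_right: "sc c (x * y) = x * sc c y"
    and sc_norm: "norm (sc c x) = cmod c * norm x"
    and st_add: "st (x + y) = st x + st y"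
    and st_sc: "st (sc c x) = sc (cnj c) (st x)"
    and st_mult: "st (x * y) = st y * st x"
    and st_st: "st (st x) = x"
    and cstar_id: "norm (st x * x) = (norm x)\<^sup>2"

text \<open>PConst a b is the constant a + i b (a, b rational); PVar i is the i-th
  indeterminate, where the indeterminates X_1..X_n, Y_1..Y_m are numbered 0..n+m-1.\<close>

datatype ncpoly = PConst rat rat | PVar nat | PAdd ncpoly ncpoly | PMul ncpoly ncpoly

fun pvars :: "ncpoly \<Rightarrow> nat set" where
  "pvars (PConst a b) = {}"
| "pvars (PVar i) = {i}"
| "pvars (PAdd p q) = pvars p \<union> pvars q"
| "pvars (PMul p q) = pvars p \<union> pvars q"

fun eval_alg :: "(complex \<Rightarrow> 'a::real_normed_algebra_1 \<Rightarrow> 'a) \<Rightarrow> 'a list \<Rightarrow> ncpoly \<Rightarrow> 'a" where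
  "eval_alg sc xs (PConst a b) = sc (Complex (of_rat a) (of_rat b)) 1"
| "eval_alg sc xs (PVar i) = xs ! i"
| "eval_alg sc xs (PAdd p q) = eval_alg sc xs p + eval_alg sc xs q"
| "eval_alg sc xs (PMul p q) = eval_alg sc xs p * eval_alg sc xs q"

fun eval_mat :: "nat \<Rightarrow> complex mat list \<Rightarrow> ncpoly \<Rightarrow> complex mat" where
  "eval_mat k As (PConst a b) = Complex (of_rat a) (of_rat b) \<cdot>\<^sub>m 1\<^sub>m k"
| "eval_mat k As (PVar i) = As ! i"
| "eval_mat k As (PAdd p q) = eval_mat k As p + eval_mat k As q"
| "eval_mat k As (PMul p q) = eval_mat k As p * eval_mat k As q"

definition adj :: "complex mat \<Rightarrow> complex mat" where
  "adj A = mat (dim_col A) (dim_row A) (\<lambda>(i,j). cnj (A $$ (j,i)))"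

definition vnorm :: "complex vec \<Rightarrow> real" where
  "vnorm v = sqrt (\<Sum>i<dim_vec v. (cmod (v $ i))\<^sup>2)"

definition opnorm :: "complex mat \<Rightarrow> real" where
  "opnorm A = Sup {vnorm (A *\<^sub>v v) | v. v \<in> carrier_vec (dim_col A) \<and> vnorm v \<le> 1}"

definition unitary_mat :: "nat \<Rightarrow> complex mat \<Rightarrow> bool" where
  "unitary_mat k W \<longleftrightarrow> W \<in> carrier_mat k k \<and> W * adj W = 1\<^sub>m k \<and> adj W * W = 1\<^sub>m k"

definition tau :: "nat \<Rightarrow> complex mat \<Rightarrow> complex" where
  "tau k A = (\<Sum>i<dim_row A. A $$ (i,i)) / of_nat k"

definition tuple_norm :: "complex mat list \<Rightarrow> real" where
  "tuple_norm As = Max (insert 0 (opnorm ` set As))"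

definition tuple_norm2 :: "nat \<Rightarrow> complex mat list \<Rightarrow> real" where
  "tuple_norm2 k As = sqrt (Re (sum_list (map (\<lambda>A. tau k (adj A * A)) As)))"

definition tuple_diff :: "complex mat list \<Rightarrow> complex mat list \<Rightarrow> complex mat list" where
  "tuple_diff As Bs = map2 (-) As Bs"

definition sa_mats :: "nat \<Rightarrow> complex mat set" where
  "sa_mats k = {A. A \<in> carrier_mat k k \<and> adj A = A}"

definition Gamma_top ::
  "(complex \<Rightarrow> 'a::real_normed_algebra_1 \<Rightarrow> 'a) \<Rightarrow> (nat \<Rightarrow> ncpoly) \<Rightarrow> 'a list \<Rightarrow> 'a list
     \<Rightarrow> real \<Rightarrow> nat \<Rightarrow> real \<Rightarrow> nat \<Rightarrow> complex mat list set" where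
  "Gamma_top sc P xs ys R k \<epsilon> r =
     {As. length As = length xs \<and> set As \<subseteq> sa_mats k \<and>
        (\<exists>Bs. length Bs = length ys \<and> set Bs \<subseteq> sa_mats k \<and>
           (\<forall>A\<in>set (As @ Bs). opnorm A \<le> R) \<and>
           (\<forall>j\<in>{1..r}. \<bar>opnorm (eval_mat k (As @ Bs) (P j)) - norm (eval_alg sc (xs @ ys) (P j))\<bar> \<le> \<epsilon>))}"

definition nu_inf :: "complex mat list set \<Rightarrow> real \<Rightarrow> enat" where
  "nu_inf \<Sigma> \<omega> = Inf {enat (card F) | F. finite F \<and> F \<subseteq> \<Sigma> \<and>
      (\<forall>A\<in>\<Sigma>. \<exists>C\<in>F. tuple_norm (tuple_diff A C) < \<omega>)}"

definition o2 :: "nat \<Rightarrow> complex mat list set \<Rightarrow> real \<Rightarrow> enat" where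
  "o2 k \<Sigma> \<omega> = Inf {enat (card F) | F. finite F \<and> F \<subseteq> \<Sigma> \<and>
      (\<forall>A\<in>\<Sigma>. \<exists>C\<in>F. \<exists>W. unitary_mat k W \<and>
          tuple_norm2 k (tuple_diff A (map (\<lambda>B. W * B * adj W) C)) < \<omega>)}"

definition elog :: "enat \<Rightarrow> ereal" where
  "elog N = (if N = 0 then -\<infinity> else if N = \<infinity> then \<infinity> else ereal (ln (real (the_enat N))))"

definition delta_top ::
  "(complex \<Rightarrow> 'a::real_normed_algebra_1 \<Rightarrow> 'a) \<Rightarrow> (nat \<Rightarrow> ncpoly) \<Rightarrow> 'a list \<Rightarrow> 'a list \<Rightarrow> ereal" where
  "delta_top sc P xs ys =
     Limsup (at_right (0::real)) (\<lambda>\<omega>.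
       SUP R\<in>{0<..}. INF \<epsilon>r\<in>{0<..} \<times> {1..}.
         limsup (\<lambda>k. elog (nu_inf (Gamma_top sc P xs ys R k (fst \<epsilon>r) (snd \<epsilon>r)) \<omega>)
                      / ereal (- (real k)\<^sup>2 * ln \<omega>)))"

definition orbit_dim_omega ::
  "(complex \<Rightarrow> 'a::real_normed_algebra_1 \<Rightarrow> 'a) \<Rightarrow> (nat \<Rightarrow> ncpoly) \<Rightarrow> 'a list \<Rightarrow> 'a list \<Rightarrow> real \<Rightarrow> ereal" where
  "orbit_dim_omega sc P xs ys \<omega> =
       (SUP R\<in>{0<..}. INF \<epsilon>r\<in>{0<..} \<times> {1..}.
         limsup (\<lambda>k. elog (o2 k (Gamma_top sc P xs ys R k (fst \<epsilon>r) (snd \<epsilon>r)) \<omega>)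
                      / ereal ((real k)\<^sup>2)))"

definition orbit_dim ::
  "(complex \<Rightarrow> 'a::real_normed_algebra_1 \<Rightarrow> 'a) \<Rightarrow> (nat \<Rightarrow> ncpoly) \<Rightarrow> 'a list \<Rightarrow> 'a list \<Rightarrow> ereal" where
  "orbit_dim sc P xs ys = Limsup (at_right (0::real)) (orbit_dim_omega sc P xs ys)"

end

theory Submission
  imports Defs
begin

text \<open>
  Since each coordinate polynomial occurs in \<open>P\<close>, the microstates with \<open>\<epsilon>\<close> small and \<open>r\<close> large
  are bounded in norm by a constant independent of \<open>R\<close>. Let an orbit net of microstates at
  scale \<open>\<omega>\<close> be given. The unitary group has a 2-norm net of at most \<open>(C / \<omega>) ^ k\<^sup>2\<close> elements;
  conjugating the orbit net by it gives a 2-norm net at scale of order \<open>\<omega>\<close>. A 2-norm ball of radius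
  \<open>c \<omega>\<close> is covered by \<open>C ^ k\<^sup>2\<close> operator norm balls of radius \<open>\<omega>\<close>, so altogether
  \<open>log \<nu> \<le> log o + k\<^sup>2 log (1 / \<omega>) + O (k\<^sup>2)\<close>. If the orbit dimension is finite, dividing by
  \<open>- k\<^sup>2 log \<omega>\<close> leaves 1 in the limit.

  The comparison of the two norms is usually done by volumes. Here the net consists of the matrices
  with entries in a lattice of mesh of order \<open>\<omega> / sqrt k\<close>, and a derandomised rounding argument
  finds, for each matrix, a lattice matrix near it in operator norm.
\<close>

no_notation Finite_Cartesian_Product.vec.vec_nth (infixl "$" 90)

section \<open>Counting and rounding to integer points\<close>

text \<open>Every net may cost at most a constant to the power \<open>k\<^sup>2\<close>, apart from
  the single factor \<open>(1 / \<omega>) ^ k\<^sup>2\<close>. A base growing like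
  \<open>sqrt k\<close> would add a term of order \<open>k\<^sup>2 * ln k\<close> to the logarithm
  and ruin the bound. Rounding entries carelessly at a mesh of order \<open>\<omega> / k\<close>
  does control the operator norm, but has exactly this defect. Lattice points are counted by their
  l1 norm and not by the range of single entries: Cauchy-Schwarz turns a 2-norm bound into a bound
  for the average entry in units of the mesh, and the integer vectors with bounded average entry are
  exponentially many in the number of coordinates, with a base depending only on the average. For
  unitaries the scale enters only after a coarse operator norm net has moved them near the identity.
  There the skew-adjoint part determines a unitary in a Lipschitz way and takes the place of the
  logarithm. Covering numbers require centres inside the covered set, so each net is moved back into
  the set at the cost of doubling the radius.\<close>

lemma sum_power_abs_int_le:
  fixes q :: real
  assumes "0 \<le> q" "q < 1"
  shows "(\<Sum>z\<in>{- int M..int M}. q ^ nat \<bar>z\<bar>) \<le> 1 + 2 * (q / (1 - q))"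
proof -
  have geo: "(\<Sum>j=1..M. q ^ j) \<le> q / (1 - q)"
  proof -
    have "(\<Sum>j=1..M. q ^ j) = q * (\<Sum>j<M. q ^ j)"
      by (simp add: sum_distrib_left sum.atLeast1_atMost_eq)
    also have "\<dots> \<le> q * (1 / (1 - q))"
      using assms by (intro mult_left_mono) (simp_all add: sum_gp_strict divide_right_mono)
    finally show ?thesis by simp
  qed
  have "{- int M..int M} = (\<lambda>j. - int j) ` {1..M} \<union> {0} \<union> int ` {1..M}" (is "_ = ?N \<union> _ \<union> ?P")
  proof (intro equalityI subsetI)
    fix z assume z: "z \<in> {- int M..int M}"
    consider "z < 0" | "z = 0" | "z > 0" by linarith
    then show "z \<in> ?N \<union> {0} \<union> ?P"
    proof cases
      case 1 then have "z = - int (nat (- z))" "nat (- z) \<in> {1..M}" using z by auto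
      then show ?thesis by blast
    next
      case 3 then have "z = int (nat z)" "nat z \<in> {1..M}" using z by auto
      then show ?thesis by blast
    qed simp
  qed auto
  moreover have "(\<Sum>z\<in>?N \<union> {0} \<union> ?P. q ^ nat \<bar>z\<bar>)
      = (\<Sum>z\<in>?N. q ^ nat \<bar>z\<bar>) + 1 + (\<Sum>z\<in>?P. q ^ nat \<bar>z\<bar>)"
    by (subst sum.union_disjoint, simp, simp, force)+ simp
  moreover have "(\<Sum>z\<in>?N. q ^ nat \<bar>z\<bar>) = (\<Sum>j=1..M. q ^ j)"
    by (subst sum.reindex) (auto simp: inj_on_def)
  moreover have "(\<Sum>z\<in>?P. q ^ nat \<bar>z\<bar>) = (\<Sum>j=1..M. q ^ j)"
    by (subst sum.reindex) (auto simp: inj_on_def)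
  ultimately show ?thesis using geo by simp
qed

text \<open>A count by exponential weights: \<open>exp (card I)\<close> times the product of the
  \<open>q ^ nat \<bar>m i\<bar>\<close> is at least 1 on \<open>S\<close>, and its sum over a box
  factorises over the coordinates. What matters is that the base depends on \<open>L\<close> alone
  and not on the dimension.\<close>

lemma card_int_l1_ball:
  fixes I :: "'i set" and L :: real
  assumes I: "finite I" and L: "L > 0"
  defines "S \<equiv> {m \<in> I \<rightarrow>\<^sub>E (UNIV :: int set). (\<Sum>i\<in>I. \<bar>real_of_int (m i)\<bar>) \<le> L * real (card I)}"
  shows "finite S" and "real (card S) \<le> (exp 1 * (1 + 2 * L)) ^ card I"
proof -
  \<comment> \<open>The box of side \<open>M\<close> keeps the sums finite; the geometric series
    bounds them uniformly in \<open>M\<close>.\<close>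
  define M where "M = nat \<lfloor>L * real (card I)\<rfloor>"
  define q where "q = exp (- (1 / L))"
  define B where "B = (I \<rightarrow>\<^sub>E {- int M..int M})"
  have SB: "S \<subseteq> B"
  proof
    fix m assume m: "m \<in> S"
    have "m i \<in> {- int M..int M}" if "i \<in> I" for i
    proof -
      have "\<bar>real_of_int (m i)\<bar> \<le> (\<Sum>i\<in>I. \<bar>real_of_int (m i)\<bar>)"
        using that I by (intro member_le_sum) auto
      also have "\<dots> \<le> L * real (card I)" using m by (simp add: S_def)
      finally have "real_of_int \<bar>m i\<bar> \<le> L * real (card I)" by simp
      then have "\<bar>m i\<bar> \<le> \<lfloor>L * real (card I)\<rfloor>" by (simp add: le_floor_iff)
      moreover have "L * real (card I) \<ge> 0" using L by simp
      ultimately show ?thesis by (auto simp: M_def)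
    qed
    then show "m \<in> B" using m by (auto simp: S_def B_def PiE_iff)
  qed
  have finB: "finite B" unfolding B_def using I by (intro finite_PiE) auto
  show fin: "finite S" using SB finB finite_subset by blast
  have q: "0 \<le> q" "q < 1" using L by (auto simp: q_def)
  \<comment> \<open>The reason for the choice of \<open>q\<close>: then
    \<open>q / (1 - q) \<le> L\<close>, so each coordinate contributes a factor of at most
    \<open>1 + 2 * L\<close>.\<close>
  have "1 + 1 / L \<le> exp (1 / L)" by (rule exp_ge_add_one_self_aux) (use L in auto)
  then have "q / (1 - q) \<le> L"
    using L q by (simp add: q_def exp_minus field_simps)
  have qpow: "q ^ nat \<bar>z\<bar> = exp (- (1 / L) * \<bar>real_of_int z\<bar>)" for z
    by (simp add: q_def exp_of_nat_mult[symmetric])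
  have "real (card S) = (\<Sum>m\<in>S. 1)" by simp
  also have "\<dots> \<le> (\<Sum>m\<in>S. exp (real (card I)) * (\<Prod>i\<in>I. q ^ nat \<bar>m i\<bar>))"
  proof (rule sum_mono)
    fix m assume m: "m \<in> S"
    have "(\<Prod>i\<in>I. q ^ nat \<bar>m i\<bar>) = exp (\<Sum>i\<in>I. - (1 / L) * \<bar>real_of_int (m i)\<bar>)"
      using I by (simp only: qpow exp_sum)
    also have "\<dots> = exp (- (1 / L) * (\<Sum>i\<in>I. \<bar>real_of_int (m i)\<bar>))"
      by (simp only: sum_distrib_left)
    finally have "exp (real (card I)) * (\<Prod>i\<in>I. q ^ nat \<bar>m i\<bar>)
        = exp (real (card I) - (1 / L) * (\<Sum>i\<in>I. \<bar>real_of_int (m i)\<bar>))"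
      by (simp add: exp_add[symmetric])
    moreover have "(1 / L) * (\<Sum>i\<in>I. \<bar>real_of_int (m i)\<bar>) \<le> real (card I)"
      using m L by (simp add: S_def field_simps)
    ultimately show "1 \<le> exp (real (card I)) * (\<Prod>i\<in>I. q ^ nat \<bar>m i\<bar>)" by simp
  qed
  also have "\<dots> \<le> (\<Sum>m\<in>B. exp (real (card I)) * (\<Prod>i\<in>I. q ^ nat \<bar>m i\<bar>))"
    using finB SB q by (intro sum_mono2 mult_nonneg_nonneg prod_nonneg) auto
  also have "\<dots> = exp (real (card I)) * (\<Prod>i\<in>I. \<Sum>z\<in>{- int M..int M}. q ^ nat \<bar>z\<bar>)"
    unfolding B_def using I by (subst prod_sum_PiE) (simp_all add: sum_distrib_left)
  also have "\<dots> \<le> exp (real (card I)) * (\<Prod>i\<in>I. 1 + 2 * L)"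
    using sum_power_abs_int_le[OF q, of M] \<open>q / (1 - q) \<le> L\<close> q
    by (intro mult_left_mono prod_mono) (auto intro!: sum_nonneg)
  also have "\<dots> = (exp 1 * (1 + 2 * L)) ^ card I"
    by (simp add: power_mult_distrib exp_of_nat_mult[symmetric])
  finally show "real (card S) \<le> (exp 1 * (1 + 2 * L)) ^ card I" .
qed

text \<open>The linear term is kept apart because it vanishes when averaged over a mean-zero
  variable, which leaves a sub-Gaussian bound.\<close>

lemma exp_le_add_exp_square:
  fixes x :: real
  shows "exp x \<le> x + exp (x\<^sup>2)"
proof -
  have sq: "1 + x\<^sup>2 \<le> exp (x\<^sup>2)" by (rule exp_ge_add_one_self_aux) simp
  consider "x \<ge> 1" | "x \<ge> 0" "x \<le> 1" | "x < 0" by linarith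
  then show ?thesis
  proof cases
    case 1
    then have "x \<le> x\<^sup>2" by (simp add: power2_eq_square)
    then have "exp x \<le> exp (x\<^sup>2)" by simp
    then show ?thesis using 1 by linarith
  next
    case 2
    then show ?thesis using exp_bound[of x] sq by linarith
  next
    case 3
    define y where "y = - x"
    have y: "y > 0" using 3 by (simp add: y_def)
    have "exp (- y) \<le> 1 - y + y\<^sup>2"
    proof (cases "y \<le> 1")
      case True
      have "1 + y \<le> exp y" by (rule exp_ge_add_one_self_aux) (use y in auto)
      then have "exp (- y) \<le> 1 / (1 + y)"
        using y by (simp add: exp_minus field_simps)
      also have "\<dots> \<le> 1 - y + y\<^sup>2"
        using y by (simp add: divide_simps power2_eq_square algebra_simps)
      finally show ?thesis .
    next
      case False
      then have "y \<le> y\<^sup>2" by (simp add: power2_eq_square)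
      moreover have "exp (- y) \<le> 1" using y by simp
      ultimately show ?thesis by linarith
    qed
    then have "exp x \<le> 1 + x + x\<^sup>2" unfolding y_def by simp
    then show ?thesis using sq by linarith
  qed
qed

text \<open>Hoeffding's lemma, with a constant that is not optimal, for the error of randomly
  rounding a number with fractional part \<open>p\<close>: it is \<open>- p\<close> with probability
  \<open>1 - p\<close> and \<open>1 - p\<close> with probability \<open>p\<close>, hence of mean
  zero and of modulus at most 1.\<close>

lemma exp_two_point_mean_le:
  fixes p c :: real
  assumes "0 \<le> p" "p \<le> 1"
  shows "(1 - p) * exp (c * (- p)) + p * exp (c * (1 - p)) \<le> exp (c\<^sup>2)"
proof -
  have *: "exp ((c * t)\<^sup>2) \<le> exp (c\<^sup>2)" if "\<bar>t\<bar> \<le> 1" for t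
  proof -
    have "t\<^sup>2 \<le> 1" using that by (simp add: abs_square_le_1)
    then have "c\<^sup>2 * t\<^sup>2 \<le> c\<^sup>2 * 1" by (intro mult_left_mono) auto
    then show ?thesis by (simp add: power_mult_distrib)
  qed
  have "exp (c * (- p)) \<le> c * (- p) + exp (c\<^sup>2)"
    using exp_le_add_exp_square[of "c * (- p)"] *[of "- p"] assms by (simp del: exp_le_cancel_iff)
  moreover have "exp (c * (1 - p)) \<le> c * (1 - p) + exp (c\<^sup>2)"
    using exp_le_add_exp_square[of "c * (1 - p)"] *[of "1 - p"] assms by (simp del: exp_le_cancel_iff)
  ultimately have "(1 - p) * exp (c * (- p)) + p * exp (c * (1 - p))
      \<le> (1 - p) * (c * (- p) + exp (c\<^sup>2)) + p * (c * (1 - p) + exp (c\<^sup>2))"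
    using assms by (intro add_mono mult_left_mono) auto
  also have "\<dots> = exp (c\<^sup>2)" by (simp add: algebra_simps)
  finally show ?thesis .
qed

text \<open>Randomised rounding, derandomised by conditional expectations: the coordinates are rounded
  one at a time, each so as not to increase the exponential potential beyond its mean.\<close>

lemma rounding_exp_potential:
  fixes c :: "'n \<Rightarrow> 'i \<Rightarrow> real" and y :: "'i \<Rightarrow> real"
  assumes "finite I" and "finite N" and "\<forall>n\<in>N. w n \<ge> 0"
  shows "\<exists>m :: 'i \<Rightarrow> int. (\<forall>i\<in>I. \<bar>of_int (m i) - y i\<bar> \<le> 1) \<and>
     (\<Sum>n\<in>N. w n * exp (\<Sum>i\<in>I. c n i * (of_int (m i) - y i))) \<le> (\<Sum>n\<in>N. w n * exp (\<Sum>i\<in>I. (c n i)\<^sup>2))"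
  using assms(1,3)
proof (induction I arbitrary: w)
  case empty
  then show ?case by simp
next
  case (insert a I)
  define p where "p = frac (y a)"
  have p: "0 \<le> p" "p \<le> 1" by (auto simp: p_def frac_ge_0 less_imp_le[OF frac_lt_1])
  \<comment> \<open>\<open>T x\<close> is the potential once coordinate \<open>a\<close> has error
    \<open>x\<close>, with the coordinates still to be rounded replaced by their bounds. Its mean
    over the two roundings is at most \<open>U\<close>, so one of them achieves
    \<open>U\<close>.\<close>
  define T where "T x = (\<Sum>n\<in>N. w n * exp (\<Sum>i\<in>I. (c n i)\<^sup>2) * exp (c n a * x))" for x
  define U where "U = (\<Sum>n\<in>N. w n * exp (\<Sum>i\<in>insert a I. (c n i)\<^sup>2))"
  have "(1 - p) * T (- p) + p * T (1 - p)
      = (\<Sum>n\<in>N. (w n * exp (\<Sum>i\<in>I. (c n i)\<^sup>2)) *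
           ((1 - p) * exp (c n a * (- p)) + p * exp (c n a * (1 - p))))"
    unfolding T_def sum_distrib_left sum.distrib[symmetric]
    by (rule sum.cong) (simp_all only: algebra_simps)
  also have "\<dots> \<le> (\<Sum>n\<in>N. (w n * exp (\<Sum>i\<in>I. (c n i)\<^sup>2)) * exp ((c n a)\<^sup>2))"
    using insert.prems p by (intro sum_mono mult_left_mono exp_two_point_mean_le) auto
  also have "\<dots> = U"
    unfolding U_def using insert.hyps by (intro sum.cong) (auto simp: exp_add)
  finally have mean: "(1 - p) * T (- p) + p * T (1 - p) \<le> U" .
  have "T (- p) \<le> U \<or> T (1 - p) \<le> U"
  proof (rule ccontr)
    assume "\<not> ?thesis"
    then have gt: "U < T (- p)" "U < T (1 - p)" by auto
    have "U = (1 - p) * U + p * U" by (simp add: algebra_simps)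
    also have "\<dots> < (1 - p) * T (- p) + p * T (1 - p)"
    proof (cases "p = 0")
      case False
      then show ?thesis using gt p
        by (intro add_le_less_mono mult_left_mono mult_strict_left_mono) auto
    qed (use gt in simp)
    finally show False using mean by simp
  qed
  then obtain z :: int where z: "\<bar>of_int z - y a\<bar> \<le> 1" "T (of_int z - y a) \<le> U"
  proof
    assume "T (- p) \<le> U"
    then show thesis using p by (intro that[of "\<lfloor>y a\<rfloor>"]) (auto simp: p_def frac_def)
  next
    assume "T (1 - p) \<le> U"
    moreover have "1 - p = of_int (\<lfloor>y a\<rfloor> + 1) - y a" by (simp add: p_def frac_def)
    ultimately show thesis using p by (intro that[of "\<lfloor>y a\<rfloor> + 1"]) auto
  qed
  \<comment> \<open>The factor of the coordinate just fixed is absorbed into the weights; this is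
    why the induction runs over arbitrary nonnegative \<open>w\<close>.\<close>
  have "\<forall>n\<in>N. w n * exp (c n a * (of_int z - y a)) \<ge> 0" using insert.prems by simp
  from insert.IH[OF this] obtain m :: "'i \<Rightarrow> int" where m: "\<forall>i\<in>I. \<bar>of_int (m i) - y i\<bar> \<le> 1"
     "(\<Sum>n\<in>N. w n * exp (c n a * (of_int z - y a)) * exp (\<Sum>i\<in>I. c n i * (of_int (m i) - y i)))
       \<le> (\<Sum>n\<in>N. w n * exp (c n a * (of_int z - y a)) * exp (\<Sum>i\<in>I. (c n i)\<^sup>2))"
    by blast
  define m' where "m' = m(a := z)"
  have eq: "(\<Sum>i\<in>insert a I. c n i * (of_int (m' i) - y i))
      = c n a * (of_int z - y a) + (\<Sum>i\<in>I. c n i * (of_int (m i) - y i))" for n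
  proof -
    have "(\<Sum>i\<in>I. c n i * (of_int (m' i) - y i)) = (\<Sum>i\<in>I. c n i * (of_int (m i) - y i))"
      using insert.hyps by (intro sum.cong) (auto simp: m'_def)
    then show ?thesis using insert.hyps by (simp add: m'_def)
  qed
  have "(\<Sum>n\<in>N. w n * exp (\<Sum>i\<in>insert a I. c n i * (of_int (m' i) - y i))) \<le> T (of_int z - y a)"
    using m(2) unfolding eq T_def by (simp add: exp_add mult_ac)
  with z(2) have "(\<Sum>n\<in>N. w n * exp (\<Sum>i\<in>insert a I. c n i * (of_int (m' i) - y i))) \<le> U" by simp
  moreover have "\<forall>i\<in>insert a I. \<bar>of_int (m' i) - y i\<bar> \<le> 1"
    using m(1) z(1) by (auto simp: m'_def)
  ultimately show ?case unfolding U_def by blast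
qed

section \<open>Bilinear forms tested on a net of the Euclidean unit ball\<close>

abbreviation bilin :: "nat \<Rightarrow> (nat \<Rightarrow> nat \<Rightarrow> real) \<Rightarrow> (nat \<Rightarrow> real) \<Rightarrow> (nat \<Rightarrow> real) \<Rightarrow> real" where
  "bilin k E x y \<equiv> \<Sum>i<k. \<Sum>j<k. x i * E i j * y j"

text \<open>The point with coordinates \<open>m i / (4 * sqrt k)\<close> lies in the Euclidean unit ball.\<close>

definition ball_net :: "nat \<Rightarrow> (nat \<Rightarrow> int) set" where
  "ball_net k = {m \<in> {..<k} \<rightarrow>\<^sub>E UNIV. L2_set (\<lambda>i. of_int (m i)) {..<k} \<le> 4 * sqrt (real k)}"

abbreviation net_pt :: "nat \<Rightarrow> (nat \<Rightarrow> int) \<Rightarrow> nat \<Rightarrow> real" where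
  "net_pt k m i \<equiv> of_int (m i) / (4 * sqrt (real k))"

lemma sum_abs_le_L2_set:
  assumes "finite I"
  shows "(\<Sum>i\<in>I. \<bar>f i\<bar>) \<le> sqrt (card I) * L2_set f I"
  using L2_set_mult_ineq[of f "\<lambda>_. 1" I] by (simp add: L2_set_constant mult.commute)

text \<open>By Cauchy-Schwarz the Euclidean bound \<open>4 * sqrt k\<close> gives l1 norm at most
  \<open>4 * k\<close>, so the l1 count applies with \<open>L = 4\<close>, and \<open>9\<close> is
  \<open>1 + 2 * 4\<close>.\<close>

lemma card_ball_net: "finite (ball_net k)" "real (card (ball_net k)) \<le> (exp 1 * 9) ^ k"
proof -
  let ?S = "{m \<in> {..<k} \<rightarrow>\<^sub>E (UNIV :: int set). (\<Sum>i<k. \<bar>real_of_int (m i)\<bar>) \<le> 4 * real (card {..<k})}"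
  have sub: "ball_net k \<subseteq> ?S"
  proof
    fix m assume m: "m \<in> ball_net k"
    have "(\<Sum>i<k. \<bar>real_of_int (m i)\<bar>) \<le> sqrt (real k) * L2_set (\<lambda>i. real_of_int (m i)) {..<k}"
      using sum_abs_le_L2_set[of "{..<k}" "\<lambda>i. real_of_int (m i)"] by simp
    also have "\<dots> \<le> sqrt (real k) * (4 * sqrt (real k))"
      using m by (intro mult_left_mono) (auto simp: ball_net_def)
    also have "\<dots> = 4 * real (card {..<k})" by simp
    finally show "m \<in> ?S" using m by (simp add: ball_net_def)
  qed
  have fin: "finite ?S" using card_int_l1_ball(1)[of "{..<k}" 4] by simp
  show "finite (ball_net k)" using sub fin finite_subset by blast
  have "real (card (ball_net k)) \<le> real (card ?S)" using card_mono[OF fin sub] by simp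
  also have "\<dots> \<le> (exp 1 * 9) ^ k" using card_int_l1_ball(2)[of "{..<k}" 4] by simp
  finally show "real (card (ball_net k)) \<le> (exp 1 * 9) ^ k" .
qed

lemma L2_set_scale: "L2_set (\<lambda>i. c * f i) A = \<bar>c\<bar> * L2_set f A" for c :: real
  unfolding L2_set_def by (simp add: power_mult_distrib sum_distrib_left[symmetric] real_sqrt_mult)

lemma L2_net_pt_le_1:
  assumes "m \<in> ball_net k" "k > 0"
  shows "L2_set (net_pt k m) {..<k} \<le> 1"
proof -
  have "L2_set (net_pt k m) {..<k} = L2_set (\<lambda>i. (1 / (4 * sqrt (real k))) * of_int (m i)) {..<k}"
    by simp
  also have "\<dots> = (1 / (4 * sqrt (real k))) * L2_set (\<lambda>i. of_int (m i)) {..<k}"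
    by (simp only: L2_set_scale) simp
  also have "\<dots> \<le> (1 / (4 * sqrt (real k))) * (4 * sqrt (real k))"
    using assms by (intro mult_left_mono) (auto simp: ball_net_def)
  finally show ?thesis using assms by simp
qed

text \<open>Coordinates are rounded towards zero, so the rounded point does not leave the ball. Each
  coordinate moves by at most \<open>1 / (4 * sqrt k)\<close>, which makes \<open>1 / 4\<close> in
  Euclidean norm.\<close>

lemma ball_net_approx:
  assumes "L2_set x {..<k} \<le> 1" and k: "k > 0"
  shows "\<exists>m\<in>ball_net k. L2_set (\<lambda>i. x i - net_pt k m i) {..<k} \<le> 1 / 4"
proof -
  define s where "s = 4 * sqrt (real k)"
  have s: "s > 0" using k by (simp add: s_def)
  define m where "m = restrict (\<lambda>i. if x i \<ge> 0 then \<lfloor>s * x i\<rfloor> else \<lceil>s * x i\<rceil>) {..<k}"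
  have m: "\<bar>of_int (m i)\<bar> \<le> \<bar>s * x i\<bar> \<and> \<bar>s * x i - of_int (m i)\<bar> \<le> 1" if "i < k" for i
  proof (cases "x i \<ge> 0")
    case True
    then have "s * x i \<ge> 0" using s by simp
    then show ?thesis using True that unfolding m_def by simp linarith
  next
    case False
    then have "s * x i \<le> 0" using s by (simp add: mult_le_0_iff)
    then show ?thesis using False that unfolding m_def by simp linarith
  qed
  have "L2_set (\<lambda>i. of_int (m i)) {..<k} = L2_set (\<lambda>i. \<bar>real_of_int (m i)\<bar>) {..<k}"
    by (simp add: L2_set_def)
  also have "\<dots> \<le> L2_set (\<lambda>i. \<bar>s * x i\<bar>) {..<k}"
    using m by (intro L2_set_mono) auto
  also have "\<dots> = s * L2_set x {..<k}"
    using s L2_set_scale[of s x "{..<k}"] by (simp add: L2_set_def)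
  also have "\<dots> \<le> s * 1" using assms s by (intro mult_left_mono) auto
  finally have "L2_set (\<lambda>i. of_int (m i)) {..<k} \<le> s" by simp
  moreover have "m \<in> {..<k} \<rightarrow>\<^sub>E UNIV" unfolding m_def by auto
  ultimately have "m \<in> ball_net k" unfolding ball_net_def s_def by blast
  moreover have "L2_set (\<lambda>i. x i - net_pt k m i) {..<k} \<le> 1 / 4"
  proof -
    have eq: "a - b / s = (1/s) * (s * a - b)" for a b using s by (simp add: field_simps)
    have "L2_set (\<lambda>i. x i - net_pt k m i) {..<k} = L2_set (\<lambda>i. (1/s) * (s * x i - of_int (m i))) {..<k}"
      unfolding s_def[symmetric] eq ..
    also have "\<dots> = (1/s) * L2_set (\<lambda>i. \<bar>s * x i - of_int (m i)\<bar>) {..<k}"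
      using s by (simp only: L2_set_scale) (simp add: L2_set_def)
    also have "\<dots> \<le> (1/s) * L2_set (\<lambda>i. 1) {..<k}"
      using s m by (intro mult_left_mono L2_set_mono) auto
    also have "\<dots> = 1 / 4" using k by (simp add: L2_set_constant s_def)
    finally show ?thesis .
  qed
  ultimately show ?thesis by blast
qed

lemma bilin_scale:
  "bilin k E (\<lambda>i. a * x i) (\<lambda>j. b * y j) = a * b * bilin k E x y"
  by (simp add: sum_distrib_left mult_ac)

lemma bilin_split:
  "bilin k E x y = bilin k E u v + bilin k E (\<lambda>i. x i - u i) y + bilin k E u (\<lambda>j. y j - v j)"
  by (simp add: sum.distrib[symmetric] algebra_simps)

text \<open>The usual net argument: moving each argument to the net costs at most
  \<open>S / 4\<close>, where \<open>S\<close> is the supremum over unit vectors, so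
  \<open>S \<le> s + S / 2\<close>. This gives \<open>S \<le> 2 * s\<close> because \<open>S\<close>
  is finite; the general case is homogeneity.\<close>

lemma bilin_le_net:
  assumes k: "k > 0"
    and net: "\<And>m n. m \<in> ball_net k \<Longrightarrow> n \<in> ball_net k \<Longrightarrow> bilin k E (net_pt k m) (net_pt k n) \<le> s"
  shows "bilin k E x y \<le> 2 * s * L2_set x {..<k} * L2_set y {..<k}"
proof -
  define B where "B = {bilin k E x y | x y. L2_set x {..<k} \<le> 1 \<and> L2_set y {..<k} \<le> 1}"
  define S where "S = Sup B"
  have coord: "\<bar>x i\<bar> \<le> 1" if "L2_set x {..<k} \<le> 1" "i < k" for x :: "nat \<Rightarrow> real" and i
  proof -
    have "\<bar>x i\<bar> \<le> L2_set (\<lambda>i. \<bar>x i\<bar>) {..<k}" using that by (intro member_le_L2_set) auto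
    also have "\<dots> = L2_set x {..<k}" by (simp add: L2_set_def)
    finally show ?thesis using that by linarith
  qed
  have bdd: "bdd_above B"
  proof (rule bdd_aboveI)
    fix b assume "b \<in> B"
    then obtain x y where b: "b = bilin k E x y" "L2_set x {..<k} \<le> 1" "L2_set y {..<k} \<le> 1"
      by (auto simp: B_def)
    show "b \<le> (\<Sum>i<k. \<Sum>j<k. \<bar>E i j\<bar>)" unfolding b(1)
    proof (intro sum_mono)
      fix i j assume "i \<in> {..<k}" "j \<in> {..<k}"
      then have "\<bar>x i\<bar> * \<bar>E i j\<bar> * \<bar>y j\<bar> \<le> 1 * \<bar>E i j\<bar> * 1"
        using b coord by (intro mult_mono) auto
      then show "x i * E i j * y j \<le> \<bar>E i j\<bar>" by (simp add: abs_mult[symmetric])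
    qed
  qed
  have S: "bilin k E x y \<le> S" if "L2_set x {..<k} \<le> 1" "L2_set y {..<k} \<le> 1" for x y
    unfolding S_def using that by (intro cSup_upper bdd) (auto simp: B_def)
  have "S \<le> s + S / 2" unfolding S_def
  proof (rule cSup_least)
    show "B \<noteq> {}" unfolding B_def by (auto intro!: exI[of _ "\<lambda>_. 0"] simp: L2_set_def)
    fix b assume "b \<in> B"
    then obtain x y where b: "b = bilin k E x y" "L2_set x {..<k} \<le> 1" "L2_set y {..<k} \<le> 1"
      by (auto simp: B_def)
    obtain m where m: "m \<in> ball_net k" "L2_set (\<lambda>i. x i - net_pt k m i) {..<k} \<le> 1 / 4"
      using ball_net_approx b k by blast
    obtain n where n: "n \<in> ball_net k" "L2_set (\<lambda>i. y i - net_pt k n i) {..<k} \<le> 1 / 4"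
      using ball_net_approx b k by blast
    have "L2_set (\<lambda>i. 4 * (x i - net_pt k m i)) {..<k} \<le> 1"
      using m(2) by (subst L2_set_scale) simp
    from S[OF this b(3)] have 1: "bilin k E (\<lambda>i. x i - net_pt k m i) y \<le> S / 4"
      using bilin_scale[of 4 "\<lambda>i. x i - net_pt k m i" E 1 y k] unfolding mult_1 by linarith
    have "L2_set (\<lambda>j. 4 * (y j - net_pt k n j)) {..<k} \<le> 1"
      using n(2) by (subst L2_set_scale) simp
    from S[OF L2_net_pt_le_1[OF m(1) k] this]
    have 2: "bilin k E (net_pt k m) (\<lambda>j. y j - net_pt k n j) \<le> S / 4"
      using bilin_scale[of 1 "net_pt k m" E 4 "\<lambda>j. y j - net_pt k n j" k] unfolding mult_1 by linarith
    show "b \<le> s + Sup B / 2"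
      using 1 2 net[OF m(1) n(1)] bilin_split[of x E y k "net_pt k m" "net_pt k n"]
      unfolding b(1) S_def by linarith
  qed
  then have S2: "S \<le> 2 * s" by simp
  let ?a = "L2_set x {..<k}" and ?b = "L2_set y {..<k}"
  show ?thesis
  proof (cases "?a = 0 \<or> ?b = 0")
    case True
    then have "bilin k E x y = 0" by (auto simp: L2_set_eq_0_iff intro!: sum.neutral)
    moreover have "2 * s * ?a * ?b = 0" using True by (simp only: mult_eq_0_iff) blast
    ultimately show ?thesis by linarith
  next
    case False
    then have pos: "?a > 0" "?b > 0" by (simp_all add: less_le)
    have "bilin k E (\<lambda>i. (1/?a) * x i) (\<lambda>j. (1/?b) * y j) \<le> S"
      using pos by (intro S; subst L2_set_scale) simp_all
    then have "1/?a * (1/?b) * bilin k E x y \<le> 2 * s"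
      unfolding bilin_scale using S2 by linarith
    then show ?thesis using pos by (simp add: field_simps)
  qed
qed

text \<open>\<open>2 * ln (exp 1 * 9)\<close> bounds the logarithm, per dimension, of the number of
  pairs of net points; \<open>1\<close> comes from the quadratic term of the potential; the outer
  \<open>2\<close> is the loss in passing from the net to all vectors.\<close>

definition round_const :: real where
  "round_const = 2 * (2 * ln (exp 1 * 9) + 1)"

lemma round_const_pos: "round_const > 0"
  by (simp add: round_const_def ln_mult add_pos_pos)

text \<open>Entrywise rounding only gives an error of order \<open>k\<close> in operator norm; a suitable choice
  of floors and ceilings brings it down to order \<open>sqrt k\<close>.\<close>

lemma integer_rounding_bilin:
  fixes y :: "nat \<Rightarrow> nat \<Rightarrow> real"
  assumes k: "k > 0"
  shows "\<exists>m :: nat \<Rightarrow> nat \<Rightarrow> int. (\<forall>i<k. \<forall>j<k. \<bar>of_int (m i j) - y i j\<bar> \<le> 1) \<and>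
     (\<forall>x z. bilin k (\<lambda>i j. of_int (m i j) - y i j) x z
            \<le> round_const * sqrt (real k) * L2_set x {..<k} * L2_set z {..<k})"
proof -
  define I where "I = {..<k} \<times> {..<k}"
  define N where "N = ball_net k \<times> ball_net k"
  \<comment> \<open>The tests are rank-one matrices built from pairs of net points. With the factor
    \<open>sqrt k\<close> the quadratic term is at most \<open>k\<close>, the same order as the
    logarithm of the number of pairs; dividing by the factor at the end leaves an error of order
    \<open>sqrt k\<close>.\<close>
  define c where "c = (\<lambda>(m, n) (i, j). sqrt (real k) * (net_pt k m i * net_pt k n j))"
  define Y where "Y = (\<lambda>(i, j). y i j)"
  have fin: "finite I" "finite N" by (auto simp: I_def N_def card_ball_net)
  from rounding_exp_potential[OF fin, of "\<lambda>_. 1" Y c] obtain M :: "nat \<times> nat \<Rightarrow> int" where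
    M: "\<forall>p\<in>I. \<bar>of_int (M p) - Y p\<bar> \<le> 1"
       "(\<Sum>n\<in>N. exp (\<Sum>p\<in>I. c n p * (of_int (M p) - Y p))) \<le> (\<Sum>n\<in>N. exp (\<Sum>p\<in>I. (c n p)\<^sup>2))"
    by auto
  define E where "E = (\<lambda>i j. of_int (M (i, j)) - y i j)"
  let ?L = "ln (exp 1 * 9 :: real)"
  have "(\<Sum>p\<in>I. (c n p)\<^sup>2) \<le> real k" if nN: "n \<in> N" for n
  proof -
    obtain m1 m2 where n: "n = (m1, m2)" "m1 \<in> ball_net k" "m2 \<in> ball_net k"
      using nN unfolding N_def by blast
    have sq: "(\<Sum>i<k. (net_pt k m i)\<^sup>2) \<le> 1" if "m \<in> ball_net k" for m
      using L2_net_pt_le_1[OF that k] by (simp add: L2_set_def)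
    have "(\<Sum>p\<in>I. (c n p)\<^sup>2) = (\<Sum>i<k. \<Sum>j<k. (c n (i, j))\<^sup>2)"
      unfolding I_def by (simp add: sum.cartesian_product)
    also have "\<dots> = (\<Sum>i<k. \<Sum>j<k. real k * ((net_pt k m1 i)\<^sup>2 * (net_pt k m2 j)\<^sup>2))"
      unfolding c_def n prod.case power_mult_distrib real_sqrt_pow2[OF of_nat_0_le_iff] ..
    also have "\<dots> = real k * ((\<Sum>i<k. (net_pt k m1 i)\<^sup>2) * (\<Sum>j<k. (net_pt k m2 j)\<^sup>2))"
      by (simp only: sum_product sum_distrib_left[symmetric])
    also have "\<dots> \<le> real k * (1 * 1)"
      using sq n by (intro mult_left_mono mult_mono) (auto intro!: sum_nonneg)
    finally show ?thesis by simp
  qed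
  then have "(\<Sum>n\<in>N. exp (\<Sum>p\<in>I. (c n p)\<^sup>2)) \<le> (\<Sum>n\<in>N. exp (real k))"
    by (intro sum_mono) auto
  also have "\<dots> = real (card (ball_net k)) * real (card (ball_net k)) * exp (real k)"
    by (simp add: N_def card_cartesian_product)
  also have "\<dots> \<le> (exp 1 * 9) ^ k * (exp 1 * 9) ^ k * exp (real k)"
    using card_ball_net(2)[of k] by (intro mult_right_mono mult_mono) auto
  also have "\<dots> = exp (real k * (2 * ?L + 1))"
  proof -
    have "(exp 1 * 9 :: real) ^ k = exp (real k * ?L)"
      by (simp only: exp_of_nat_mult) simp
    then show ?thesis by (simp add: exp_add[symmetric] algebra_simps)
  qed
  finally have tot: "(\<Sum>n\<in>N. exp (\<Sum>p\<in>I. c n p * (of_int (M p) - Y p))) \<le> exp (real k * (2 * ?L + 1))"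
    using M(2) by linarith
  have net: "bilin k E (net_pt k m) (net_pt k n) \<le> sqrt (real k) * (2 * ?L + 1)"
    if "m \<in> ball_net k" "n \<in> ball_net k" for m n
  proof -
    \<comment> \<open>The union bound in deterministic form: all terms of the potential are
      positive, so each is at most the total.\<close>
    have "exp (\<Sum>p\<in>I. c (m, n) p * (of_int (M p) - Y p))
        \<le> (\<Sum>n\<in>N. exp (\<Sum>p\<in>I. c n p * (of_int (M p) - Y p)))"
      using fin that by (intro member_le_sum) (auto simp: N_def)
    with tot have "exp (\<Sum>p\<in>I. c (m, n) p * (of_int (M p) - Y p)) \<le> exp (real k * (2 * ?L + 1))"
      by linarith
    then have "(\<Sum>p\<in>I. c (m, n) p * (of_int (M p) - Y p)) \<le> real k * (2 * ?L + 1)" by simp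
    also have "(\<Sum>p\<in>I. c (m, n) p * (of_int (M p) - Y p))
        = (\<Sum>i<k. \<Sum>j<k. c (m, n) (i, j) * (of_int (M (i, j)) - Y (i, j)))"
      unfolding I_def by (simp add: sum.cartesian_product)
    also have "\<dots> = sqrt (real k) * bilin k E (net_pt k m) (net_pt k n)"
      unfolding c_def Y_def E_def prod.case sum_distrib_left
      by (intro sum.cong refl) (simp only: mult_ac)
    also have "real k * (2 * ?L + 1) = sqrt (real k) * (sqrt (real k) * (2 * ?L + 1))"
      by (simp add: mult.assoc[symmetric])
    finally show ?thesis using k by (simp only: mult_le_cancel_left) simp
  qed
  have "bilin k E x z \<le> round_const * sqrt (real k) * L2_set x {..<k} * L2_set z {..<k}" for x z
  proof -
    have eq: "2 * (sqrt (real k) * (2 * ?L + 1)) = round_const * sqrt (real k)"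
      unfolding round_const_def by (simp only: mult_ac)
    show ?thesis using bilin_le_net[OF k net, of x z] unfolding eq .
  qed
  then have "\<forall>x z. bilin k (\<lambda>i j. of_int (M (i, j)) - y i j) x z
      \<le> round_const * sqrt (real k) * L2_set x {..<k} * L2_set z {..<k}"
    unfolding E_def by blast
  moreover have "\<forall>i<k. \<forall>j<k. \<bar>of_int (M (i, j)) - y i j\<bar> \<le> 1"
    using M(1) by (auto simp: I_def Y_def)
  ultimately show ?thesis by (intro exI[of _ "\<lambda>i j. M (i, j)"] conjI)
qed

section \<open>Hilbert-Schmidt and operator norms\<close>

text \<open>The unnormalised norm: on \<open>k\<close> by \<open>k\<close> matrices it is
  \<open>sqrt k\<close> times the 2-norm of the normalised trace, hence the factor
  \<open>sqrt (real k)\<close> in all radii below.\<close>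

definition hs :: "complex mat \<Rightarrow> real" where
  "hs A = L2_set (\<lambda>(i, j). cmod (A $$ (i, j))) ({..<dim_row A} \<times> {..<dim_col A})"

lemma hs_nonneg [simp]: "hs A \<ge> 0"
  by (simp add: hs_def)

lemma hs_eq:
  assumes "A \<in> carrier_mat m n"
  shows "hs A = L2_set (\<lambda>(i, j). cmod (A $$ (i, j))) ({..<m} \<times> {..<n})"
  using assms by (auto simp: hs_def)

lemma hs_add_le:
  assumes "A \<in> carrier_mat m n" "B \<in> carrier_mat m n"
  shows "hs (A + B) \<le> hs A + hs B"
proof -
  have "hs (A + B) = L2_set (\<lambda>p. cmod (A $$ p + B $$ p)) ({..<m} \<times> {..<n})"
    unfolding hs_eq[OF add_carrier_mat[OF assms(2)], of A] using assms
    by (intro L2_set_cong) auto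
  also have "\<dots> \<le> L2_set (\<lambda>p. cmod (A $$ p) + cmod (B $$ p)) ({..<m} \<times> {..<n})"
    by (intro L2_set_mono norm_triangle_ineq) auto
  also have "\<dots> \<le> L2_set (\<lambda>p. cmod (A $$ p)) ({..<m} \<times> {..<n}) + L2_set (\<lambda>p. cmod (B $$ p)) ({..<m} \<times> {..<n})"
    by (rule L2_set_triangle_ineq)
  also have "\<dots> = hs A + hs B"
    unfolding hs_eq[OF assms(1)] hs_eq[OF assms(2)] by (simp add: case_prod_unfold)
  finally show ?thesis .
qed

lemma hs_minus_le:
  assumes "A \<in> carrier_mat m n" "B \<in> carrier_mat m n" "C \<in> carrier_mat m n"
  shows "hs (A - C) \<le> hs (A - B) + hs (B - C)"
proof -
  have "A - C = (A - B) + (B - C)" using assms by (intro eq_matI) auto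
  then show ?thesis using hs_add_le[of "A - B" m n "B - C"] assms by (simp add: minus_carrier_mat)
qed

lemma hs_minus_commute:
  assumes "A \<in> carrier_mat m n" "B \<in> carrier_mat m n"
  shows "hs (A - B) = hs (B - A)"
  unfolding hs_eq[OF minus_carrier_mat[OF assms(1)], of B] hs_eq[OF minus_carrier_mat[OF assms(2)], of A]
  using assms by (intro L2_set_cong) (auto simp: norm_minus_commute)

lemma hs_diff_le:
  assumes "A \<in> carrier_mat m n" "B \<in> carrier_mat m n"
  shows "hs (A - B) \<le> hs A + hs B"
proof -
  have zero: "C - 0\<^sub>m m n = C" if "C \<in> carrier_mat m n" for C :: "complex mat"
    using that by (intro eq_matI) auto
  show ?thesis
    using hs_minus_le[OF assms(1) zero_carrier_mat assms(2)]
      hs_minus_commute[OF zero_carrier_mat assms(2)] zero assms by simp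
qed

lemma adj_carrier [simp]: "A \<in> carrier_mat m n \<Longrightarrow> adj A \<in> carrier_mat n m"
  by (auto simp: adj_def)

lemma dim_adj [simp]: "dim_row (adj A) = dim_col A" "dim_col (adj A) = dim_row A"
  by (auto simp: adj_def)

lemma adj_index [simp]: "i < dim_col A \<Longrightarrow> j < dim_row A \<Longrightarrow> adj A $$ (i, j) = cnj (A $$ (j, i))"
  by (simp add: adj_def)

lemma adj_adj [simp]: "adj (adj A) = A"
  by (intro eq_matI) auto

lemma adj_minus: "A \<in> carrier_mat m n \<Longrightarrow> B \<in> carrier_mat m n \<Longrightarrow> adj (A - B) = adj A - adj B"
  by (intro eq_matI) auto

lemma adj_one: "adj (1\<^sub>m k) = 1\<^sub>m k"
  by (intro eq_matI) (auto simp: one_mat_def)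

lemma adj_mult:
  assumes "A \<in> carrier_mat m n" "B \<in> carrier_mat n p"
  shows "adj (A * B) = adj B * adj A"
  using assms by (intro eq_matI) (auto simp: scalar_prod_def mult.commute)

lemma hs_adj [simp]: "hs (adj A) = hs A"
proof -
  have "(\<Sum>(i, j)\<in>{..<dim_col A} \<times> {..<dim_row A}. (cmod (A $$ (j, i)))\<^sup>2)
      = (\<Sum>(i, j)\<in>{..<dim_row A} \<times> {..<dim_col A}. (cmod (A $$ (i, j)))\<^sup>2)"
    unfolding sum.cartesian_product[symmetric] by (rule sum.swap)
  moreover have "(\<Sum>x\<in>{..<dim_col A} \<times> {..<dim_row A}. (case x of (i, j) \<Rightarrow> cmod (adj A $$ (i, j)))\<^sup>2)
      = (\<Sum>(i, j)\<in>{..<dim_col A} \<times> {..<dim_row A}. (cmod (A $$ (j, i)))\<^sup>2)"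
    by (intro sum.cong) auto
  moreover have "(\<Sum>x\<in>{..<dim_row A} \<times> {..<dim_col A}. (case x of (i, j) \<Rightarrow> cmod (A $$ (i, j)))\<^sup>2)
      = (\<Sum>(i, j)\<in>{..<dim_row A} \<times> {..<dim_col A}. (cmod (A $$ (i, j)))\<^sup>2)"
    by (intro sum.cong) auto
  ultimately show ?thesis by (simp only: hs_def L2_set_def dim_adj)
qed

lemma hs_sq: "(hs A)\<^sup>2 = (\<Sum>i<dim_row A. \<Sum>j<dim_col A. (cmod (A $$ (i, j)))\<^sup>2)"
  by (simp add: hs_def L2_set_def sum.cartesian_product case_prod_unfold sum_nonneg)

lemma hs_sq_trace:
  "complex_of_real ((hs A)\<^sup>2) = (\<Sum>j<dim_col A. (adj A * A) $$ (j, j))"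
proof -
  have "(\<Sum>j<dim_col A. (adj A * A) $$ (j, j))
      = (\<Sum>j<dim_col A. \<Sum>i<dim_row A. cnj (A $$ (i, j)) * A $$ (i, j))"
    by (intro sum.cong refl) (auto simp: scalar_prod_def atLeast0LessThan intro!: sum.cong)
  also have "\<dots> = (\<Sum>i<dim_row A. \<Sum>j<dim_col A. cnj (A $$ (i, j)) * A $$ (i, j))"
    by (rule sum.swap)
  also have "\<dots> = complex_of_real ((hs A)\<^sup>2)"
    by (simp add: hs_sq complex_norm_square mult.commute del: of_real_power)
  finally show ?thesis by simp
qed

lemma tau_adj_mult_self: "A \<in> carrier_mat k k \<Longrightarrow> tau k (adj A * A) = complex_of_real ((hs A)\<^sup>2 / real k)"
  using hs_sq_trace[of A] by (auto simp: tau_def)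

lemma unitary_carrier [simp]: "unitary_mat k U \<Longrightarrow> U \<in> carrier_mat k k"
  by (simp add: unitary_mat_def)

lemma unitary_adj [simp]: "unitary_mat k U \<Longrightarrow> unitary_mat k (adj U)"
  by (simp add: unitary_mat_def)

lemma unitary_mult [simp]:
  assumes "unitary_mat k U" "unitary_mat k V"
  shows "unitary_mat k (U * V)"
proof -
  note c = assms[THEN unitary_carrier] assms[THEN unitary_adj, THEN unitary_carrier]
  have "(U * V) * (adj V * adj U) = U * (V * adj V) * adj U"
    "(adj V * adj U) * (U * V) = adj V * (adj U * U) * V"
    using c by (simp_all add: assoc_mult_mat[of _ k k _ k _ k] mult_carrier_mat[of _ k k _ k])
  then show ?thesis using assms c
    by (simp add: unitary_mat_def adj_mult[of _ k k _ k])
qed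

lemma hs_unitary_mult:
  assumes U: "unitary_mat k U" and A: "A \<in> carrier_mat k n"
  shows "hs (U * A) = hs A"
proof -
  have c: "U \<in> carrier_mat k k" "adj U \<in> carrier_mat k k" using U by auto
  have "adj (U * A) * (U * A) = adj A * (adj U * U) * A"
    using A c by (simp add: adj_mult[OF c(1) A] assoc_mult_mat[of _ n k _ k _ n]
        assoc_mult_mat[of _ n k _ k _ k] assoc_mult_mat[of _ k k _ k _ n]
        mult_carrier_mat[of _ k k _ k] mult_carrier_mat[of _ k k _ n] mult_carrier_mat[of _ n k _ k])
  also have "\<dots> = adj A * A" using A U by (simp add: unitary_mat_def)
  finally have "complex_of_real ((hs (U * A))\<^sup>2) = complex_of_real ((hs A)\<^sup>2)"
    using A c by (simp add: hs_sq_trace del: of_real_power)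
  then have "(hs (U * A))\<^sup>2 = (hs A)\<^sup>2" by (simp only: of_real_eq_iff)
  then show ?thesis by (simp add: power2_eq_iff_nonneg)
qed

lemma hs_mult_unitary:
  assumes U: "unitary_mat k U" and A: "A \<in> carrier_mat n k"
  shows "hs (A * U) = hs A"
proof -
  have "hs (A * U) = hs (adj (A * U))" by simp
  also have "\<dots> = hs (adj U * adj A)" using A U by (simp add: adj_mult[of _ n k _ k])
  also have "\<dots> = hs A" using A U by (subst hs_unitary_mult[of k _ _ n]) auto
  finally show ?thesis .
qed

lemma hs_unitary: "unitary_mat k U \<Longrightarrow> hs U = sqrt (real k)"
proof -
  assume U: "unitary_mat k U"
  then have "U \<in> carrier_mat k k" by simp
  then have "complex_of_real ((hs U)\<^sup>2) = complex_of_real (real k)"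
    unfolding hs_sq_trace using U by (simp add: unitary_mat_def one_mat_def)
  then have "(hs U)\<^sup>2 = real k" by (simp only: of_real_eq_iff)
  then show ?thesis by (metis hs_nonneg real_sqrt_unique)
qed

section \<open>The operator norm\<close>

lemma vnorm_eq: "v \<in> carrier_vec n \<Longrightarrow> vnorm v = L2_set (\<lambda>i. cmod (v $ i)) {..<n}"
  by (auto simp: vnorm_def L2_set_def)

lemma vnorm_nonneg [simp]: "vnorm v \<ge> 0"
  by (simp add: vnorm_def sum_nonneg)

lemma vnorm_add_le:
  assumes "u \<in> carrier_vec n" "v \<in> carrier_vec n"
  shows "vnorm (u + v) \<le> vnorm u + vnorm v"
proof -
  have "vnorm (u + v) = L2_set (\<lambda>i. cmod (u $ i + v $ i)) {..<n}"
    using assms by (simp add: vnorm_eq[of _ n]) (intro L2_set_cong, auto)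
  also have "\<dots> \<le> L2_set (\<lambda>i. cmod (u $ i) + cmod (v $ i)) {..<n}"
    by (intro L2_set_mono norm_triangle_ineq) auto
  also have "\<dots> \<le> L2_set (\<lambda>i. cmod (u $ i)) {..<n} + L2_set (\<lambda>i. cmod (v $ i)) {..<n}"
    by (rule L2_set_triangle_ineq)
  finally show ?thesis using assms by (simp add: vnorm_eq[of _ n])
qed

lemma vnorm_smult: "vnorm (c \<cdot>\<^sub>v v) = cmod c * vnorm v"
  by (simp add: vnorm_def norm_mult power_mult_distrib sum_distrib_left[symmetric] real_sqrt_mult)

lemma mult_mat_vec_index:
  assumes "A \<in> carrier_mat m n" "v \<in> carrier_vec n" "i < m"
  shows "(A *\<^sub>v v) $ i = (\<Sum>j<n. A $$ (i, j) * v $ j)"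
  using assms by (auto simp: scalar_prod_def atLeast0LessThan intro!: sum.cong)

text \<open>Cauchy-Schwarz in each row. This crude bound shows that the supremum defining
  \<open>opnorm\<close> is taken over a bounded set.\<close>

lemma vnorm_mult_le_hs:
  assumes A: "A \<in> carrier_mat m n" and v: "v \<in> carrier_vec n"
  shows "vnorm (A *\<^sub>v v) \<le> hs A * vnorm v"
proof -
  have "vnorm (A *\<^sub>v v) = L2_set (\<lambda>i. cmod (\<Sum>j<n. A $$ (i, j) * v $ j)) {..<m}"
    using A v mult_mat_vec_index[OF A v]
    by (simp add: vnorm_eq[OF mult_mat_vec_carrier[OF A v]] cong: L2_set_cong_simp del: index_mult_mat_vec)
  also have "\<dots> \<le> L2_set (\<lambda>i. L2_set (\<lambda>j. cmod (A $$ (i, j))) {..<n} * vnorm v) {..<m}"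
  proof (intro L2_set_mono)
    fix i
    have "cmod (\<Sum>j<n. A $$ (i, j) * v $ j) \<le> (\<Sum>j<n. \<bar>cmod (A $$ (i, j))\<bar> * \<bar>cmod (v $ j)\<bar>)"
      by (rule order_trans[OF norm_sum]) (simp add: norm_mult)
    also have "\<dots> \<le> L2_set (\<lambda>j. cmod (A $$ (i, j))) {..<n} * L2_set (\<lambda>j. cmod (v $ j)) {..<n}"
      by (rule L2_set_mult_ineq)
    finally show "cmod (\<Sum>j<n. A $$ (i, j) * v $ j) \<le> L2_set (\<lambda>j. cmod (A $$ (i, j))) {..<n} * vnorm v"
      by (simp add: vnorm_eq[OF v])
  qed auto
  also have "\<dots> = L2_set (\<lambda>i. L2_set (\<lambda>j. cmod (A $$ (i, j))) {..<n}) {..<m} * vnorm v"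
    by (simp add: L2_set_left_distrib)
  also have "L2_set (\<lambda>i. L2_set (\<lambda>j. cmod (A $$ (i, j))) {..<n}) {..<m} = hs A"
    unfolding hs_eq[OF A]
    by (simp add: L2_set_def sum_nonneg sum.cartesian_product case_prod_unfold)
  finally show ?thesis .
qed

lemma opnorm_bdd_above: "bdd_above {vnorm (A *\<^sub>v v) | v. v \<in> carrier_vec (dim_col A) \<and> vnorm v \<le> 1}"
proof (rule bdd_aboveI)
  fix b assume "b \<in> {vnorm (A *\<^sub>v v) | v. v \<in> carrier_vec (dim_col A) \<and> vnorm v \<le> 1}"
  then obtain u where u: "b = vnorm (A *\<^sub>v u)" "u \<in> carrier_vec (dim_col A)" "vnorm u \<le> 1" by auto
  have "vnorm (A *\<^sub>v u) \<le> hs A * vnorm u" using u by (intro vnorm_mult_le_hs) auto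
  also have "\<dots> \<le> hs A * 1" using u(3) by (intro mult_left_mono) auto
  finally show "b \<le> hs A" using u(1) by simp
qed

lemma vnorm_mult_le_opnorm:
  assumes A: "A \<in> carrier_mat m n" and v: "v \<in> carrier_vec n"
  shows "vnorm (A *\<^sub>v v) \<le> opnorm A * vnorm v"
proof (cases "vnorm v = 0")
  case True
  then show ?thesis using vnorm_mult_le_hs[OF A v] by simp
next
  case False
  then have pos: "vnorm v > 0" by (simp add: less_le)
  define w where "w = complex_of_real (1 / vnorm v) \<cdot>\<^sub>v v"
  have w: "w \<in> carrier_vec n" "vnorm w = 1"
    using v pos by (auto simp: w_def vnorm_smult norm_divide)
  have "vnorm (A *\<^sub>v w) \<le> opnorm A"
    unfolding opnorm_def using w A by (intro cSup_upper opnorm_bdd_above) auto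
  moreover have "vnorm (A *\<^sub>v w) = vnorm (A *\<^sub>v v) / vnorm v"
    using A v pos by (simp add: w_def mult_mat_vec[of _ m n] vnorm_smult norm_divide)
  ultimately show ?thesis using pos by (simp add: field_simps)
qed

lemma opnorm_le:
  assumes A: "A \<in> carrier_mat m n" and "c \<ge> 0"
    and "\<And>v. v \<in> carrier_vec n \<Longrightarrow> vnorm (A *\<^sub>v v) \<le> c * vnorm v"
  shows "opnorm A \<le> c"
  unfolding opnorm_def
proof (rule cSup_least)
  have "0\<^sub>v n \<in> carrier_vec (dim_col A)" "vnorm (0\<^sub>v n) \<le> 1" using A by (auto simp: vnorm_def)
  then show "{vnorm (A *\<^sub>v v) |v. v \<in> carrier_vec (dim_col A) \<and> vnorm v \<le> 1} \<noteq> {}" by blast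
  fix b assume "b \<in> {vnorm (A *\<^sub>v v) |v. v \<in> carrier_vec (dim_col A) \<and> vnorm v \<le> 1}"
  then obtain v where v: "b = vnorm (A *\<^sub>v v)" "v \<in> carrier_vec n" "vnorm v \<le> 1" using A by auto
  have "b \<le> c * vnorm v" using assms(3) v by simp
  also have "\<dots> \<le> c * 1" using v assms(2) by (intro mult_left_mono) auto
  finally show "b \<le> c" by simp
qed

lemma opnorm_nonneg [simp]: "opnorm A \<ge> 0"
proof -
  have "0 \<le> vnorm (A *\<^sub>v 0\<^sub>v (dim_col A))" by simp
  also have "\<dots> \<le> opnorm A"
    unfolding opnorm_def
    by (intro cSup_upper opnorm_bdd_above CollectI exI[of _ "0\<^sub>v (dim_col A)"]) (simp add: vnorm_def)
  finally show ?thesis .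
qed

lemma opnorm_add_le:
  assumes "A \<in> carrier_mat m n" "B \<in> carrier_mat m n"
  shows "opnorm (A + B) \<le> opnorm A + opnorm B"
proof (rule opnorm_le[of _ m n])
  fix v :: "complex Matrix.vec" assume v: "v \<in> carrier_vec n"
  have "vnorm ((A + B) *\<^sub>v v) \<le> vnorm (A *\<^sub>v v) + vnorm (B *\<^sub>v v)"
    using assms v by (simp add: add_mult_distrib_mat_vec[of _ m n] vnorm_add_le[of _ m])
  also have "\<dots> \<le> (opnorm A + opnorm B) * vnorm v"
    using vnorm_mult_le_opnorm[OF assms(1) v] vnorm_mult_le_opnorm[OF assms(2) v]
    by (simp add: algebra_simps)
  finally show "vnorm ((A + B) *\<^sub>v v) \<le> (opnorm A + opnorm B) * vnorm v" .
qed (use assms in auto)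

lemma opnorm_smult_le:
  assumes "A \<in> carrier_mat m n"
  shows "opnorm (c \<cdot>\<^sub>m A) \<le> cmod c * opnorm A"
proof (rule opnorm_le[of _ m n])
  fix v :: "complex Matrix.vec" assume v: "v \<in> carrier_vec n"
  have "(c \<cdot>\<^sub>m A) *\<^sub>v v = c \<cdot>\<^sub>v (A *\<^sub>v v)"
    using assms v by (intro eq_vecI) (auto simp: scalar_prod_def sum_distrib_left mult_ac)
  then show "vnorm ((c \<cdot>\<^sub>m A) *\<^sub>v v) \<le> cmod c * opnorm A * vnorm v"
    using vnorm_mult_le_opnorm[OF assms v] by (simp add: vnorm_smult mult.assoc mult_left_mono)
qed (use assms in auto)

lemma opnorm_minus_commute:
  assumes "A \<in> carrier_mat m n" "B \<in> carrier_mat m n"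
  shows "opnorm (A - B) = opnorm (B - A)"
proof -
  have *: "opnorm (A - B) \<le> opnorm (B - A)" if "A \<in> carrier_mat m n" "B \<in> carrier_mat m n" for A B
  proof -
    have "A - B = (- 1) \<cdot>\<^sub>m (B - A)" using that by (intro eq_matI) auto
    then show ?thesis using opnorm_smult_le[of "B - A" m n "- 1"] that by (simp add: minus_carrier_mat)
  qed
  show ?thesis using *[OF assms] *[OF assms(2,1)] by simp
qed

lemma opnorm_minus_le:
  assumes "A \<in> carrier_mat m n" "B \<in> carrier_mat m n" "C \<in> carrier_mat m n"
  shows "opnorm (A - C) \<le> opnorm (A - B) + opnorm (B - C)"
proof -
  have "A - C = (A - B) + (B - C)" using assms by (intro eq_matI) auto
  then show ?thesis using opnorm_add_le[of "A - B" m n "B - C"] assms by (simp add: minus_carrier_mat)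
qed

text \<open>The square of \<open>hs\<close> is the sum of the squared norms of the columns, and
  \<open>A\<close> acts on each column of \<open>B\<close> separately.\<close>

lemma hs_mult_le:
  assumes A: "A \<in> carrier_mat m n" and B: "B \<in> carrier_mat n p"
  shows "hs (A * B) \<le> opnorm A * hs B"
proof -
  have cols: "(hs C)\<^sup>2 = (\<Sum>j<q. (vnorm (col C j))\<^sup>2)" if "C \<in> carrier_mat l q" for C l q
  proof -
    have "(\<Sum>j<q. (vnorm (col C j))\<^sup>2) = (\<Sum>j<q. \<Sum>i<l. (cmod (C $$ (i, j)))\<^sup>2)"
      using that by (intro sum.cong) (auto simp: vnorm_def sum_nonneg)
    also have "\<dots> = (\<Sum>i<l. \<Sum>j<q. (cmod (C $$ (i, j)))\<^sup>2)" by (rule sum.swap)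
    finally show ?thesis using that by (auto simp: hs_sq)
  qed
  have "(hs (A * B))\<^sup>2 = (\<Sum>j<p. (vnorm (A *\<^sub>v col B j))\<^sup>2)"
    using A B by (simp add: cols[of _ m p] col_mult2[of _ m n _ p])
  also have "\<dots> \<le> (\<Sum>j<p. (opnorm A * vnorm (col B j))\<^sup>2)"
    using B by (intro sum_mono power_mono vnorm_mult_le_opnorm[OF A]) auto
  also have "\<dots> = (opnorm A * hs B)\<^sup>2"
    by (simp add: power_mult_distrib cols[OF B] sum_distrib_left)
  finally show ?thesis by (rule power2_le_imp_le) simp
qed

section \<open>Covering numbers\<close>

text \<open>The form is tested on the image vector itself: with \<open>y = E a\<close>, the squared
  norm of \<open>y\<close> is at most \<open>b\<close> times the norms of \<open>y\<close> and
  \<open>a\<close>, and one factor cancels.\<close>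

lemma real_mat_L2_bound:
  assumes b: "\<And>x z. bilin k E x z \<le> b * L2_set x {..<k} * L2_set z {..<k}" and "b \<ge> 0"
  shows "(\<Sum>i<k. (\<Sum>j<k. E i j * a j)\<^sup>2) \<le> b\<^sup>2 * (\<Sum>j<k. (a j)\<^sup>2)"
proof -
  define y where "y i = (\<Sum>j<k. E i j * a j)" for i
  have "L2_set y {..<k} * L2_set y {..<k} = (\<Sum>i<k. (y i)\<^sup>2)"
    by (simp add: L2_set_def sum_nonneg)
  also have "\<dots> = (\<Sum>i<k. y i * (\<Sum>j<k. E i j * a j))"
    by (simp add: power2_eq_square y_def)
  also have "\<dots> = bilin k E y a" unfolding sum_distrib_left by (simp add: mult.assoc)
  also have "\<dots> \<le> b * L2_set y {..<k} * L2_set a {..<k}" by (rule b)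
  finally have *: "L2_set y {..<k} * L2_set y {..<k} \<le> (b * L2_set a {..<k}) * L2_set y {..<k}"
    by (simp only: mult_ac)
  have "L2_set y {..<k} \<le> b * L2_set a {..<k}"
  proof (cases "L2_set y {..<k} = 0")
    case False
    then have "L2_set y {..<k} > 0" by (simp add: less_le)
    then show ?thesis using * by simp
  qed (use assms in simp)
  then have "(L2_set y {..<k})\<^sup>2 \<le> (b * L2_set a {..<k})\<^sup>2"
    by (intro power_mono) auto
  then show ?thesis by (simp add: L2_set_def sum_nonneg power_mult_distrib y_def)
qed

text \<open>A real matrix acts separately on the real and imaginary parts of a vector, so the bound
  passes from real to complex vectors without loss.\<close>

lemma opnorm_of_real_mat_le:
  assumes b: "\<And>x z. bilin k E x z \<le> b * L2_set x {..<k} * L2_set z {..<k}" and "b \<ge> 0"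
  shows "opnorm (mat k k (\<lambda>(i, j). complex_of_real (E i j))) \<le> b"
proof (rule opnorm_le[of _ k k])
  let ?A = "mat k k (\<lambda>(i, j). complex_of_real (E i j))"
  show A: "?A \<in> carrier_mat k k" by simp
  fix v :: "complex Matrix.vec" assume v: "v \<in> carrier_vec k"
  have "(vnorm (?A *\<^sub>v v))\<^sup>2 = (\<Sum>i<k. (cmod ((?A *\<^sub>v v) $ i))\<^sup>2)"
    by (simp add: vnorm_def sum_nonneg)
  also have "\<dots> = (\<Sum>i<k. (\<Sum>j<k. E i j * Re (v $ j))\<^sup>2 + (\<Sum>j<k. E i j * Im (v $ j))\<^sup>2)"
  proof (intro sum.cong refl)
    fix i assume i: "i \<in> {..<k}"
    have "(?A *\<^sub>v v) $ i = (\<Sum>j<k. complex_of_real (E i j) * v $ j)"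
      using i by (subst mult_mat_vec_index[OF A v]) auto
    then show "(cmod ((?A *\<^sub>v v) $ i))\<^sup>2 = (\<Sum>j<k. E i j * Re (v $ j))\<^sup>2 + (\<Sum>j<k. E i j * Im (v $ j))\<^sup>2"
      by (simp add: cmod_power2)
  qed
  also have "\<dots> \<le> b\<^sup>2 * (\<Sum>j<k. (Re (v $ j))\<^sup>2) + b\<^sup>2 * (\<Sum>j<k. (Im (v $ j))\<^sup>2)"
    unfolding sum.distrib by (intro add_mono real_mat_L2_bound assms)
  also have "\<dots> = (b * vnorm v)\<^sup>2"
    using v by (simp add: vnorm_def sum_nonneg power_mult_distrib cmod_power2 sum.distrib algebra_simps)
  finally show "vnorm (?A *\<^sub>v v) \<le> b * vnorm v"
    by (rule power2_le_imp_le) (use assms in auto)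
qed fact

lemma opnorm_cover:
  fixes c :: real
  assumes "c \<ge> 0"
  shows "\<exists>C\<ge>1. \<forall>k>0. \<forall>t>0. \<exists>F. F \<subseteq> carrier_mat k k \<and> finite F \<and> real (card F) \<le> C ^ k\<^sup>2 \<and>
     (\<forall>A\<in>carrier_mat k k. hs A \<le> c * t * sqrt (real k) \<longrightarrow> (\<exists>B\<in>F. opnorm (A - B) \<le> t))"
proof -
  \<comment> \<open>In units of the mesh \<open>l\<close> below, the entries of \<open>A\<close>
    have average modulus at most \<open>2 * c * round_const\<close>, by Cauchy-Schwarz over the
    \<open>k\<^sup>2\<close> entries; the extra \<open>1\<close> allows for the rounding.\<close>
  define L where "L = 2 * c * round_const + 1"
  have L: "L > 0" using assms round_const_pos by (simp add: L_def add_nonneg_pos)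
  \<comment> \<open>Squared because real and imaginary parts are rounded separately.\<close>
  define C where "C = (exp 1 * (1 + 2 * L))\<^sup>2"
  have "1 * 1 \<le> exp 1 * (1 + 2 * L)" using L by (intro mult_mono) auto
  then have C: "C \<ge> 1" by (simp add: C_def)
  show ?thesis
  proof (intro exI[of _ C] conjI C allI impI)
    fix k :: nat and t :: real assume k: "k > 0" and t: "t > 0"
    \<comment> \<open>With this mesh the real and the imaginary part each contribute an operator
      norm error of at most \<open>t / 2\<close>.\<close>
    define l where "l = t / (2 * round_const * sqrt (real k))"
    have l: "l > 0" using k t round_const_pos by (simp add: l_def)
    define I where "I = {..<k} \<times> {..<k}"
    define M where "M = {m \<in> I \<rightarrow>\<^sub>E (UNIV :: int set). (\<Sum>p\<in>I. \<bar>real_of_int (m p)\<bar>) \<le> L * real (card I)}"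
    have cardI: "card I = k\<^sup>2" by (simp add: I_def card_cartesian_product power2_eq_square)
    have finI: "finite I" by (simp add: I_def)
    have M: "finite M" "real (card M) \<le> (exp 1 * (1 + 2 * L)) ^ k\<^sup>2"
      using card_int_l1_ball[OF finI L] unfolding M_def cardI by auto
    define g :: "(nat \<times> nat \<Rightarrow> int) \<times> (nat \<times> nat \<Rightarrow> int) \<Rightarrow> complex mat"
      where "g = (\<lambda>(m, n). mat k k (\<lambda>p. complex_of_real l * Complex (of_int (m p)) (of_int (n p))))"
    show "\<exists>F. F \<subseteq> carrier_mat k k \<and> finite F \<and> real (card F) \<le> C ^ k\<^sup>2 \<and>
     (\<forall>A\<in>carrier_mat k k. hs A \<le> c * t * sqrt (real k) \<longrightarrow> (\<exists>B\<in>F. opnorm (A - B) \<le> t))"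
    proof (intro exI[of _ "g ` (M \<times> M)"] conjI ballI impI)
      show "g ` (M \<times> M) \<subseteq> carrier_mat k k" by (auto simp: g_def)
      show "finite (g ` (M \<times> M))" using M by simp
      have "card (g ` (M \<times> M)) \<le> card M * card M"
        using card_image_le[of "M \<times> M" g] M by (simp add: card_cartesian_product)
      then have "real (card (g ` (M \<times> M))) \<le> real (card M) * real (card M)"
        by (metis of_nat_le_iff of_nat_mult)
      also have "\<dots> \<le> (exp 1 * (1 + 2 * L)) ^ k\<^sup>2 * (exp 1 * (1 + 2 * L)) ^ k\<^sup>2"
        using M L by (intro mult_mono) auto
      also have "\<dots> = C ^ k\<^sup>2"
        unfolding C_def power2_eq_square[of "exp 1 * (1 + 2 * L)"] power_mult_distrib[symmetric] ..
      finally show "real (card (g ` (M \<times> M))) \<le> C ^ k\<^sup>2" .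
      fix A :: "complex mat" assume A: "A \<in> carrier_mat k k" and hsA: "hs A \<le> c * t * sqrt (real k)"
      have round: "\<exists>m\<in>M. opnorm (mat k k (\<lambda>p. complex_of_real (f (A $$ p) / l - of_int (m p)))) \<le> round_const * sqrt (real k)"
        if f: "\<And>z. \<bar>f z\<bar> \<le> cmod z" for f
      proof -
        \<comment> \<open>The negative is rounded and \<open>m'\<close> restores the sign, so that
          \<open>m - y\<close> is the entry in units of \<open>l\<close> minus its approximation, as
          needed below.\<close>
        define y where "y i j = - f (A $$ (i, j)) / l" for i j
        from integer_rounding_bilin[OF k, of y] obtain m :: "nat \<Rightarrow> nat \<Rightarrow> int" where
          m: "\<And>i j. i < k \<Longrightarrow> j < k \<Longrightarrow> \<bar>of_int (m i j) - y i j\<bar> \<le> 1"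
          "\<And>x z. bilin k (\<lambda>i j. of_int (m i j) - y i j) x z
            \<le> round_const * sqrt (real k) * L2_set x {..<k} * L2_set z {..<k}"
          by blast
        define m' where "m' = restrict (\<lambda>(i, j). - m i j) I"
        have "(\<Sum>p\<in>I. \<bar>real_of_int (m' p)\<bar>) \<le> (\<Sum>p\<in>I. \<bar>cmod (A $$ p)\<bar> / l + 1)"
        proof (intro sum_mono)
          fix p assume "p \<in> I"
          then obtain i j where p: "p = (i, j)" "i < k" "j < k" by (auto simp: I_def)
          have "\<bar>y i j\<bar> \<le> \<bar>cmod (A $$ p)\<bar> / l"
            using f[of "A $$ p"] l by (simp add: y_def p divide_right_mono)
          then show "\<bar>real_of_int (m' p)\<bar> \<le> \<bar>cmod (A $$ p)\<bar> / l + 1"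
            using m(1)[OF p(2,3)] p by (simp add: m'_def I_def)
        qed
        also have "\<dots> = (\<Sum>p\<in>I. \<bar>cmod (A $$ p)\<bar>) / l + real (card I)"
          by (simp add: sum.distrib sum_divide_distrib)
        also have "(\<Sum>p\<in>I. \<bar>cmod (A $$ p)\<bar>) \<le> sqrt (card I) * L2_set (\<lambda>p. cmod (A $$ p)) I"
          by (rule sum_abs_le_L2_set[OF finI])
        also have "\<dots> = real k * hs A"
          by (simp add: hs_eq[OF A] I_def cardI[unfolded I_def] case_prod_unfold)
        also have "\<dots> \<le> real k * (c * t * sqrt (real k))" using hsA by (intro mult_left_mono) auto
        also have "real k * (c * t * sqrt (real k)) / l = real (k\<^sup>2) * (2 * c * round_const)"
          using k t round_const_pos by (simp add: l_def field_simps power2_eq_square)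
        finally have "(\<Sum>p\<in>I. \<bar>real_of_int (m' p)\<bar>) \<le> L * real (card I)"
          using l by (simp add: divide_right_mono cardI L_def algebra_simps)
        then have m'M: "m' \<in> M" by (simp add: M_def m'_def)
        have "opnorm (mat k k (\<lambda>(i, j). complex_of_real (of_int (m i j) - y i j))) \<le> round_const * sqrt (real k)"
          using m(2) round_const_pos by (intro opnorm_of_real_mat_le) auto
        also have "mat k k (\<lambda>(i, j). complex_of_real (of_int (m i j) - y i j))
            = mat k k (\<lambda>p. complex_of_real (f (A $$ p) / l - of_int (m' p)))"
          by (intro eq_matI) (auto simp: y_def m'_def I_def)
        finally show ?thesis using m'M by blast
      qed
      from round[of Re] obtain m where m: "m \<in> M"
        "opnorm (mat k k (\<lambda>p. complex_of_real (Re (A $$ p) / l - of_int (m p)))) \<le> round_const * sqrt (real k)"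
        using abs_Re_le_cmod by blast
      from round[of Im] obtain n where n: "n \<in> M"
        "opnorm (mat k k (\<lambda>p. complex_of_real (Im (A $$ p) / l - of_int (n p)))) \<le> round_const * sqrt (real k)"
        using abs_Im_le_cmod by blast
      let ?X = "mat k k (\<lambda>p. complex_of_real (Re (A $$ p) / l - of_int (m p)))"
      let ?Y = "mat k k (\<lambda>p. complex_of_real (Im (A $$ p) / l - of_int (n p)))"
      have eq: "A - g (m, n) = complex_of_real l \<cdot>\<^sub>m ?X + (\<i> * complex_of_real l) \<cdot>\<^sub>m ?Y"
        using A l by (intro eq_matI) (auto simp: g_def complex_eq_iff field_simps)
      have "opnorm (A - g (m, n)) \<le> opnorm (complex_of_real l \<cdot>\<^sub>m ?X) + opnorm ((\<i> * complex_of_real l) \<cdot>\<^sub>m ?Y)"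
        unfolding eq by (rule opnorm_add_le[of _ k k]) auto
      also have "\<dots> \<le> l * opnorm ?X + l * opnorm ?Y"
        using opnorm_smult_le[of ?X k k "complex_of_real l"] opnorm_smult_le[of ?Y k k "\<i> * complex_of_real l"] l
        by (intro add_mono) (auto simp: norm_mult)
      also have "\<dots> \<le> l * (round_const * sqrt (real k)) + l * (round_const * sqrt (real k))"
        using m(2) n(2) l by (intro add_mono mult_left_mono) auto
      also have "\<dots> = t" using k round_const_pos by (simp add: l_def)
      finally show "\<exists>B\<in>g ` (M \<times> M). opnorm (A - B) \<le> t" using m(1) n(1) by blast
    qed
  qed
qed

text \<open>Each label in use is replaced by one chosen point of \<open>S\<close> carrying it.
  Labels need not be points: below they are also tuples of discrete data, and
  \<open>R a l \<and> R b l\<close> stands for the doubled radius.\<close>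

lemma recenter_cover:
  assumes "finite F" and "\<forall>a\<in>S. \<exists>l\<in>F. R a l"
  shows "\<exists>G\<subseteq>S. finite G \<and> card G \<le> card F \<and> (\<forall>a\<in>S. \<exists>b\<in>G. \<exists>l\<in>F. R a l \<and> R b l)"
proof -
  define F' where "F' = {l \<in> F. \<exists>a\<in>S. R a l}"
  define h where "h l = (SOME a. a \<in> S \<and> R a l)" for l
  have h: "h l \<in> S \<and> R (h l) l" if "l \<in> F'" for l
    using that unfolding F'_def h_def by (auto intro: someI2)
  have fin: "finite F'" "card F' \<le> card F" using assms(1) by (auto simp: F'_def intro: card_mono)
  show ?thesis
  proof (intro exI[of _ "h ` F'"] conjI ballI)
    show "h ` F' \<subseteq> S" using h by blast
    show "finite (h ` F')" using fin by simp
    show "card (h ` F') \<le> card F" using card_image_le[OF fin(1), of h] fin(2) by linarith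
    fix a assume "a \<in> S"
    then obtain l where "l \<in> F" "R a l" using assms(2) by blast
    then have "l \<in> F'" using \<open>a \<in> S\<close> by (auto simp: F'_def)
    then show "\<exists>b\<in>h ` F'. \<exists>l\<in>F. R a l \<and> R b l" using h \<open>l \<in> F\<close> \<open>R a l\<close> by blast
  qed
qed

section \<open>A Hilbert-Schmidt net of the unitary group\<close>

text \<open>Nearness to 1 is essential, since \<open>1\<close> and \<open>- 1\<close> have the same
  skew part. With \<open>D = V - V'\<close>, the difference of the skew parts is
  \<open>D - adj D\<close>, and it falls short of \<open>2 D\<close> by \<open>D + adj D\<close>.
  This splits into \<open>?Y + ?Z\<close>, each of norm at most a quarter of that of
  \<open>D\<close>, which leaves \<open>2 - 1/4 - 1/4 = 3/2\<close>.\<close>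

lemma hs_diff_le_skew_part:
  assumes U: "unitary_mat k V" "unitary_mat k V'"
    and near: "\<And>X. X \<in> carrier_mat k k \<Longrightarrow> hs ((V - 1\<^sub>m k) * X) \<le> 1 / 4 * hs X"
      "\<And>X. X \<in> carrier_mat k k \<Longrightarrow> hs ((V' - 1\<^sub>m k) * X) \<le> 1 / 4 * hs X"
  shows "3 / 2 * hs (V - V') \<le> hs ((V - adj V) - (V' - adj V'))"
proof -
  note c[simp] = U[THEN unitary_carrier] U[THEN unitary_adj, THEN unitary_carrier]
  note mc[simp] = mult_carrier_mat[of _ k k _ k] minus_carrier_mat[of _ k k]
  define D where "D = V - V'"
  have D[simp]: "D \<in> carrier_mat k k" "adj D \<in> carrier_mat k k" by (simp_all add: D_def)
  have VV: "V * adj V = 1\<^sub>m k" "adj V' * V' = 1\<^sub>m k" using U by (simp_all add: unitary_mat_def)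
  text \<open>Unitarity makes \<open>adj D\<close> nearly \<open>- D\<close> when \<open>V\<close> and \<open>V'\<close> are near 1.\<close>
  have "adj V' * D * adj V = (adj V' * V) * adj V - (adj V' * V') * adj V"
    by (simp add: D_def mult_minus_distrib_mat[of _ k k _ k] minus_mult_distrib_mat[of _ k k _ _ k])
  also have "(adj V' * V) * adj V = adj V'"
    by (simp add: assoc_mult_mat[of _ k k _ k _ k] VV right_mult_one_mat[of _ k k])
  also have "(adj V' * V') * adj V = adj V" by (simp add: VV left_mult_one_mat[of _ k k])
  finally have DVV: "adj V' * D * adj V = adj V' - adj V" .
  let ?X = "(V - adj V) - (V' - adj V')"
  let ?Y = "adj V' * (V' - 1\<^sub>m k) * D"
  let ?Z = "adj V' * (D * (1\<^sub>m k - adj V))"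
  have Y: "?Y = D - adj V' * D"
    by (simp add: mult_minus_distrib_mat[of _ k k _ k] minus_mult_distrib_mat[of _ k k _ _ k] VV
        right_mult_one_mat[of _ k k] left_mult_one_mat[of _ k k])
  have Z: "?Z = adj V' * D - adj V' * D * adj V"
    by (simp add: right_mult_one_mat[of _ k k] mult_minus_distrib_mat[of _ k k _ k] assoc_mult_mat[of _ k k _ k _ k])
  have D2: "2 \<cdot>\<^sub>m D = ?X + (?Y + ?Z)"
    unfolding Y Z DVV using c D by (intro eq_matI) (auto simp: D_def simp del: c D)
  have "hs (2 \<cdot>\<^sub>m D) = 2 * hs D"
  proof -
    have "hs (2 \<cdot>\<^sub>m D) = L2_set (\<lambda>p. 2 * (case p of (i, j) \<Rightarrow> cmod (D $$ (i, j)))) ({..<k} \<times> {..<k})"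
      unfolding hs_eq[OF smult_carrier_mat[OF D(1)]] using D(1)
      by (intro L2_set_cong) (auto simp: norm_mult simp del: D)
    then show ?thesis by (simp add: L2_set_scale hs_eq[OF D(1)] case_prod_unfold)
  qed
  then have "2 * hs D = hs (?X + (?Y + ?Z))" by (simp only: D2)
  moreover have "hs (?X + (?Y + ?Z)) \<le> hs ?X + (hs ?Y + hs ?Z)"
    using hs_add_le[of ?X k k "?Y + ?Z"] hs_add_le[of ?Y k k ?Z] by (simp add: add_carrier_mat)
  moreover have "hs ?Y \<le> 1 / 4 * hs D"
  proof -
    have "?Y = adj V' * ((V' - 1\<^sub>m k) * D)" by (simp add: assoc_mult_mat[of _ k k _ k _ k])
    then have "hs ?Y = hs ((V' - 1\<^sub>m k) * D)"
      using U by (simp add: hs_unitary_mult[of k _ _ k])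
    then show ?thesis using near(2)[OF D(1)] by simp
  qed
  moreover have "hs ?Z \<le> 1 / 4 * hs D"
  proof -
    have "hs ?Z = hs (D * (1\<^sub>m k - adj V))"
      using U by (simp add: hs_unitary_mult[of k _ _ k])
    \<comment> \<open>Taking adjoints brings the small factor to the left, where \<open>near\<close>
      applies.\<close>
    also have "\<dots> = hs (adj (D * (1\<^sub>m k - adj V)))" by simp
    also have "adj (D * (1\<^sub>m k - adj V)) = (1\<^sub>m k - V) * adj D"
      by (simp add: adj_mult[of _ k k _ k] adj_minus[of _ k k] adj_one)
    also have "hs ((1\<^sub>m k - V) * adj D) = hs ((V - 1\<^sub>m k) * adj D)"
    proof -
      have "(1\<^sub>m k - V) * adj D = adj D - V * adj D" "(V - 1\<^sub>m k) * adj D = V * adj D - adj D"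
        by (simp_all add: minus_mult_distrib_mat[of _ k k _ _ k] left_mult_one_mat[of _ k k])
      then show ?thesis by (simp add: hs_minus_commute[of _ k k])
    qed
    also have "\<dots> \<le> 1 / 4 * hs (adj D)" by (rule near(1)) simp
    finally show ?thesis by simp
  qed
  ultimately have "2 * hs D \<le> hs ?X + (1 / 4 * hs D + 1 / 4 * hs D)" by linarith
  then show ?thesis by (simp add: D_def)
qed

text \<open>A skew-adjoint matrix is determined by \<open>k\<^sup>2\<close> real numbers: this is where the exponent
  \<open>k\<^sup>2\<close>, rather than \<open>2 k\<^sup>2\<close>, in the covering number of the unitary group comes from.\<close>

definition skew_param :: "complex mat \<Rightarrow> nat \<times> nat \<Rightarrow> real" where
  "skew_param K = (\<lambda>(i, j). if i < j then Re (K $$ (i, j)) else Im (K $$ (i, j)))"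

lemma abs_skew_param_le: "\<bar>skew_param K p\<bar> \<le> cmod (K $$ p)"
  by (cases p) (simp add: skew_param_def abs_Re_le_cmod abs_Im_le_cmod)

text \<open>The real parts form an antisymmetric and the imaginary parts a symmetric matrix, so the
  parameters control every entry up to \<open>sqrt 2\<close>. The constant is enlarged to
  \<open>3 / 2\<close> so that it cancels against the one in
  \<open>hs_diff_le_skew_part\<close>.\<close>

lemma hs_skew_le:
  assumes K: "K \<in> carrier_mat k k" "adj K = - K" and b: "b \<ge> 0"
    and p: "\<And>i j. i < k \<Longrightarrow> j < k \<Longrightarrow> \<bar>skew_param K (i, j)\<bar> \<le> b"
  shows "hs K \<le> 3 / 2 * b * real k"
proof -
  have skew: "Re (K $$ (j, i)) = - Re (K $$ (i, j))" "Im (K $$ (j, i)) = Im (K $$ (i, j))"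
    if "i < k" "j < k" for i j
  proof -
    have "adj K $$ (i, j) = (- K) $$ (i, j)" using K by simp
    then have "cnj (K $$ (j, i)) = - (K $$ (i, j))" using K(1) that by simp
    then show "Re (K $$ (j, i)) = - Re (K $$ (i, j))" "Im (K $$ (j, i)) = Im (K $$ (i, j))"
      by (simp_all add: complex_eq_iff)
  qed
  have entry: "(cmod (K $$ (i, j)))\<^sup>2 \<le> 2 * b\<^sup>2" if ij: "i < k" "j < k" for i j
  proof -
    have "\<bar>Re (K $$ (i, j))\<bar> \<le> b"
      using p[OF ij] p[OF ij(2,1)] skew[OF ij] skew[OF ij(1,1)] b
      by (cases i j rule: linorder_cases) (auto simp: skew_param_def)
    moreover have "\<bar>Im (K $$ (i, j))\<bar> \<le> b"
      using p[OF ij] p[OF ij(2,1)] skew[OF ij] 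
      by (cases i j rule: linorder_cases) (auto simp: skew_param_def)
    ultimately have "(Re (K $$ (i, j)))\<^sup>2 \<le> b\<^sup>2" "(Im (K $$ (i, j)))\<^sup>2 \<le> b\<^sup>2"
      using b by (simp_all add: abs_le_square_iff[symmetric])
    then show ?thesis by (simp add: cmod_power2)
  qed
  have "(hs K)\<^sup>2 \<le> (\<Sum>i<k. \<Sum>j<k. 2 * b\<^sup>2)"
    unfolding hs_sq carrier_matD[OF K(1)] using entry by (intro sum_mono) auto
  also have "\<dots> = 2 * (b * real k)\<^sup>2" by (simp add: power_mult_distrib power2_eq_square)
  also have "\<dots> \<le> (9 / 4) * (b * real k)\<^sup>2" by (intro mult_right_mono) auto
  also have "\<dots> = (3 / 2 * b * real k)\<^sup>2" by (simp add: power2_eq_square)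
  finally show ?thesis by (rule power2_le_imp_le) (use b in simp)
qed

text \<open>Two scales: a coarse net in operator norm, of constant cost per dimension, and around
  each of its points \<open>U0\<close> the skew part of \<open>adj U0 * U\<close>, rounded at mesh
  \<open>\<eta> / sqrt k\<close>. Only the second depends on \<eta>.\<close>

lemma unitary_cover:
  "\<exists>C\<ge>1. \<forall>k>0. \<forall>\<eta>. 0 < \<eta> \<and> \<eta> \<le> 1 \<longrightarrow> (\<exists>F. F \<subseteq> Collect (unitary_mat k) \<and> finite F \<and>
     real (card F) \<le> (C / \<eta>) ^ k\<^sup>2 \<and>
     (\<forall>U. unitary_mat k U \<longrightarrow> (\<exists>U'\<in>F. hs (U - U') \<le> \<eta> * sqrt (real k))))"
proof -
  from opnorm_cover[of 8] obtain C0 where C0: "C0 \<ge> 1" and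
    cover: "\<And>k t. k > 0 \<Longrightarrow> t > 0 \<Longrightarrow> \<exists>F. F \<subseteq> carrier_mat k k \<and> finite F \<and> real (card F) \<le> C0 ^ k\<^sup>2 \<and>
     (\<forall>A\<in>carrier_mat k k. hs A \<le> 8 * t * sqrt (real k) \<longrightarrow> (\<exists>B\<in>F. opnorm (A - B) \<le> t))"
    by auto
  \<comment> \<open>\<open>7\<close> arises from
    \<open>1 + 2 * L = 3 + 4 / \<eta> \<le> 7 / \<eta>\<close>, as \<eta> is at most 1.\<close>
  define C where "C = C0 * (exp 1 * 7)"
  have "1 * (1 * 1) \<le> C0 * (exp 1 * 7)" using C0 by (intro mult_mono) auto
  then have C: "C \<ge> 1" by (simp add: C_def)
  show ?thesis
  proof (intro exI[of _ C] conjI C allI impI)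
    fix k :: nat and \<eta> :: real assume k: "k > 0" and \<eta>: "0 < \<eta> \<and> \<eta> \<le> 1"
    note mc[simp] = mult_carrier_mat[of _ k k _ k] minus_carrier_mat[of _ k k]
    let ?U = "Collect (unitary_mat k)"
    obtain F0 where F0: "F0 \<subseteq> carrier_mat k k" "finite F0" "real (card F0) \<le> C0 ^ k\<^sup>2"
      "\<forall>A\<in>carrier_mat k k. hs A \<le> 8 * (1/8) * sqrt (real k) \<longrightarrow> (\<exists>B\<in>F0. opnorm (A - B) \<le> 1/8)"
      using cover[OF k, of "1/8"] by auto
    have "\<forall>U\<in>?U. \<exists>B\<in>F0. opnorm (U - B) \<le> 1/8" using F0(4) by (simp add: hs_unitary)
    from recenter_cover[OF F0(2) this] obtain G0 where
      G0: "G0 \<subseteq> ?U" "finite G0" "card G0 \<le> card F0"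
        "\<forall>U\<in>?U. \<exists>U0\<in>G0. \<exists>B\<in>F0. opnorm (U - B) \<le> 1/8 \<and> opnorm (U0 - B) \<le> 1/8" by blast
    have near: "\<exists>U0\<in>G0. opnorm (U - U0) \<le> 1/4" if U: "unitary_mat k U" for U
    proof -
      from G0(4) U obtain U0 B where B: "U0 \<in> G0" "B \<in> F0" "opnorm (U - B) \<le> 1/8" "opnorm (U0 - B) \<le> 1/8"
        by blast
      have c: "U \<in> carrier_mat k k" "U0 \<in> carrier_mat k k" "B \<in> carrier_mat k k"
        using U B G0(1) F0(1) by auto
      have "opnorm (U - U0) \<le> opnorm (U - B) + opnorm (B - U0)" by (rule opnorm_minus_le[OF c(1,3,2)])
      also have "opnorm (B - U0) = opnorm (U0 - B)" by (rule opnorm_minus_commute[OF c(3,2)])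
      finally show ?thesis using B by (intro bexI[of _ U0]) auto
    qed
    define I where "I = {..<k} \<times> {..<k}"
    \<comment> \<open>Since \<open>hs (K U0 U) \<le> 2 * sqrt k\<close>, the average entry in units
      of the mesh \<open>\<eta> / sqrt k\<close> is at most \<open>2 / \<eta>\<close>; the
      \<open>1\<close> pays for the floor.\<close>
    define L where "L = 1 + 2 / \<eta>"
    have L: "L > 0" using \<eta> by (simp add: L_def add_pos_pos)
    have cardI: "card I = k\<^sup>2" by (simp add: I_def card_cartesian_product power2_eq_square)
    have finI: "finite I" by (simp add: I_def)
    define M where "M = {m \<in> I \<rightarrow>\<^sub>E (UNIV :: int set). (\<Sum>p\<in>I. \<bar>real_of_int (m p)\<bar>) \<le> L * real (card I)}"
    have M: "finite M" "real (card M) \<le> (exp 1 * (1 + 2 * L)) ^ k\<^sup>2"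
      using card_int_l1_ball[OF finI L] unfolding M_def cardI by auto
    define K where "K U0 U = adj U0 * U - adj (adj U0 * U)" for U0 U
    define m where "m U0 U = restrict (\<lambda>p. \<lfloor>skew_param (K U0 U) p * sqrt (real k) / \<eta>\<rfloor>) I" for U0 U
    \<comment> \<open>The label of a unitary is a coarse centre with the rounded skew parameters
      relative to it; unitaries sharing a label turn out to be within
      \<open>\<eta> * sqrt k\<close>.\<close>
    define Q where "Q U = (\<lambda>(U0, n). opnorm (U - U0) \<le> 1/4 \<and> m U0 U = n)" for U
    have Kc[simp]: "K U0 U \<in> carrier_mat k k" if "unitary_mat k U0" "unitary_mat k U" for U0 U
      using that by (simp add: K_def)
    have mM: "m U0 U \<in> M" if U: "unitary_mat k U0" "unitary_mat k U" for U0 U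
    proof -
      have VU: "unitary_mat k (adj U0 * U)" using U by simp
      have "hs (K U0 U) \<le> hs (adj U0 * U) + hs (adj (adj U0 * U))"
        unfolding K_def using VU by (intro hs_diff_le[of _ k k]) auto
      also have "\<dots> = 2 * sqrt (real k)" using hs_unitary[OF VU] by simp
      finally have hsK: "hs (K U0 U) \<le> 2 * sqrt (real k)" .
      have "(\<Sum>p\<in>I. \<bar>cmod (K U0 U $$ p)\<bar>) \<le> sqrt (card I) * L2_set (\<lambda>p. cmod (K U0 U $$ p)) I"
        by (rule sum_abs_le_L2_set[OF finI])
      also have "\<dots> = real k * hs (K U0 U)"
        using hs_eq[OF Kc[OF U]] by (simp add: I_def cardI[unfolded I_def] case_prod_unfold)
      also have "\<dots> \<le> real k * (2 * sqrt (real k))" using hsK by (intro mult_left_mono) auto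
      finally have l1: "(\<Sum>p\<in>I. \<bar>cmod (K U0 U $$ p)\<bar>) \<le> real k * (2 * sqrt (real k))" .
      have "(\<Sum>p\<in>I. \<bar>real_of_int (m U0 U p)\<bar>) \<le> (\<Sum>p\<in>I. \<bar>cmod (K U0 U $$ p)\<bar> * (sqrt (real k) / \<eta>) + 1)"
      proof (intro sum_mono)
        fix p assume "p \<in> I"
        then have "m U0 U p = \<lfloor>skew_param (K U0 U) p * (sqrt (real k) / \<eta>)\<rfloor>" by (simp add: m_def)
        then have "\<bar>real_of_int (m U0 U p)\<bar> \<le> \<bar>skew_param (K U0 U) p * (sqrt (real k) / \<eta>)\<bar> + 1" by linarith
        also have "\<bar>skew_param (K U0 U) p * (sqrt (real k) / \<eta>)\<bar> = \<bar>skew_param (K U0 U) p\<bar> * (sqrt (real k) / \<eta>)"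
          using \<eta> by (simp add: abs_mult)
        also have "\<dots> \<le> \<bar>cmod (K U0 U $$ p)\<bar> * (sqrt (real k) / \<eta>)"
          using abs_skew_param_le[of "K U0 U" p] \<eta> by (intro mult_right_mono) auto
        finally show "\<bar>real_of_int (m U0 U p)\<bar> \<le> \<bar>cmod (K U0 U $$ p)\<bar> * (sqrt (real k) / \<eta>) + 1" by simp
      qed
      also have "\<dots> = (\<Sum>p\<in>I. \<bar>cmod (K U0 U $$ p)\<bar>) * (sqrt (real k) / \<eta>) + real (k\<^sup>2)"
        by (simp only: sum.distrib sum_distrib_right sum_constant cardI)
      also have "\<dots> \<le> real k * (2 * sqrt (real k)) * (sqrt (real k) / \<eta>) + real (k\<^sup>2)"
        using l1 \<eta> by (intro add_right_mono mult_right_mono) auto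
      also have "\<dots> = L * real (card I)"
        using \<eta> by (simp add: L_def cardI field_simps power2_eq_square)
      finally have "(\<Sum>p\<in>I. \<bar>real_of_int (m U0 U p)\<bar>) \<le> L * real (card I)" .
      then show ?thesis by (simp add: M_def m_def)
    qed
    have Q1: "\<forall>U\<in>?U. \<exists>l\<in>G0 \<times> M. Q U l"
    proof
      fix U assume "U \<in> ?U"
      then have U: "unitary_mat k U" by simp
      from near[OF U] obtain U0 where "U0 \<in> G0" "opnorm (U - U0) \<le> 1/4" by blast
      moreover have "m U0 U \<in> M" using mM U G0(1) \<open>U0 \<in> G0\<close> by blast
      ultimately show "\<exists>l\<in>G0 \<times> M. Q U l" by (intro bexI[of _ "(U0, m U0 U)"]) (auto simp: Q_def)
    qed
    have Q2: "hs (U - U') \<le> \<eta> * sqrt (real k)"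
      if U: "unitary_mat k U" "unitary_mat k U'" and Q: "Q U l" "Q U' l" "l \<in> G0 \<times> M" for U U' l
    proof -
      obtain U0 n where l: "l = (U0, n)" "U0 \<in> G0" by (cases l) (use Q in auto)
      have U0: "unitary_mat k U0" using l G0 by auto
      note c[simp] = U[THEN unitary_carrier] U0[THEN unitary_carrier] U0[THEN unitary_adj, THEN unitary_carrier]
      define V where "V = adj U0 * U"
      define V' where "V' = adj U0 * U'"
      have VU: "unitary_mat k V" "unitary_mat k V'" using U U0 by (simp_all add: V_def V'_def)
      note Vc[simp] = VU[THEN unitary_carrier] VU[THEN unitary_adj, THEN unitary_carrier]
      have *: "hs ((adj U0 * W - 1\<^sub>m k) * X) \<le> 1/4 * hs X"
        if W: "W \<in> carrier_mat k k" "opnorm (W - U0) \<le> 1/4" and X: "X \<in> carrier_mat k k" for W X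
      proof -
        have "adj U0 * W - 1\<^sub>m k = adj U0 * (W - U0)"
          using U0 W by (simp add: mult_minus_distrib_mat[of _ k k _ k] unitary_mat_def)
        then have "(adj U0 * W - 1\<^sub>m k) * X = adj U0 * ((W - U0) * X)"
          using W X by (simp add: assoc_mult_mat[of _ k k _ k _ k])
        then have "hs ((adj U0 * W - 1\<^sub>m k) * X) = hs ((W - U0) * X)"
          using W X U0 by (simp add: hs_unitary_mult[of k _ _ k])
        also have "\<dots> \<le> opnorm (W - U0) * hs X" using W X by (intro hs_mult_le[of _ k k]) auto
        also have "\<dots> \<le> 1/4 * hs X" using W by (intro mult_right_mono) auto
        finally show ?thesis .
      qed
      have op: "opnorm (U - U0) \<le> 1/4" "opnorm (U' - U0) \<le> 1/4" and mm: "m U0 U = m U0 U'"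
        using Q by (auto simp: Q_def l)
      have "3/2 * hs (V - V') \<le> hs ((V - adj V) - (V' - adj V'))"
        unfolding V_def V'_def
        by (rule hs_diff_le_skew_part[OF VU[unfolded V_def V'_def] *[OF _ op(1)] *[OF _ op(2)]]) auto
      also have "(V - adj V) - (V' - adj V') = K U0 U - K U0 U'"
        by (simp add: K_def V_def V'_def)
      also have "hs (K U0 U - K U0 U') \<le> 3/2 * (\<eta> / sqrt (real k)) * real k"
      proof (rule hs_skew_le)
        have KV: "K U0 U = V - adj V" "K U0 U' = V' - adj V'" by (simp_all add: K_def V_def V'_def)
        show "K U0 U - K U0 U' \<in> carrier_mat k k" using U U0 by simp
        show "adj (K U0 U - K U0 U') = - (K U0 U - K U0 U')"
          unfolding KV by (intro eq_matI) (use Vc in \<open>auto simp del: Vc\<close>)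
        show "0 \<le> \<eta> / sqrt (real k)" using \<eta> by simp
        fix i j assume ij: "i < k" "j < k"
        let ?a = "skew_param (K U0 U) (i, j)" and ?b = "skew_param (K U0 U') (i, j)"
        have "m U0 U (i, j) = m U0 U' (i, j)" using mm by simp
        then have "\<lfloor>?a * sqrt (real k) / \<eta>\<rfloor> = \<lfloor>?b * sqrt (real k) / \<eta>\<rfloor>"
          using ij by (simp add: m_def I_def)
        then have "\<bar>?a * sqrt (real k) / \<eta> - ?b * sqrt (real k) / \<eta>\<bar> \<le> 1" by linarith
        also have "?a * sqrt (real k) / \<eta> - ?b * sqrt (real k) / \<eta> = (?a - ?b) * (sqrt (real k) / \<eta>)"
          by (simp add: algebra_simps diff_divide_distrib)
        finally have "\<bar>?a - ?b\<bar> * (sqrt (real k) / \<eta>) \<le> 1" using \<eta> by (simp add: abs_mult)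
        then have "\<bar>?a - ?b\<bar> \<le> \<eta> / sqrt (real k)" using \<eta> k by (simp add: field_simps)
        moreover have "skew_param (K U0 U - K U0 U') (i, j) = ?a - ?b"
          using ij Kc[OF U0 U(1)] Kc[OF U0 U(2)] by (auto simp: skew_param_def simp del: Kc)
        ultimately show "\<bar>skew_param (K U0 U - K U0 U') (i, j)\<bar> \<le> \<eta> / sqrt (real k)" by simp
      qed
      also have "3/2 * (\<eta> / sqrt (real k)) * real k = 3/2 * (\<eta> * sqrt (real k))"
        using k by (simp add: field_simps)
      finally have "hs (V - V') \<le> \<eta> * sqrt (real k)" by simp
      moreover have "V - V' = adj U0 * (U - U')"
        by (simp add: V_def V'_def mult_minus_distrib_mat[of _ k k _ k])
      ultimately show ?thesis using U0 by (simp add: hs_unitary_mult[of k _ _ k])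
    qed
    have fin: "finite (G0 \<times> M)" using G0 M by simp
    from recenter_cover[OF fin Q1] obtain G where G: "G \<subseteq> ?U" "finite G" "card G \<le> card (G0 \<times> M)"
      "\<forall>U\<in>?U. \<exists>U'\<in>G. \<exists>l\<in>G0 \<times> M. Q U l \<and> Q U' l" by blast
    show "\<exists>F. F \<subseteq> ?U \<and> finite F \<and> real (card F) \<le> (C / \<eta>) ^ k\<^sup>2 \<and>
     (\<forall>U. unitary_mat k U \<longrightarrow> (\<exists>U'\<in>F. hs (U - U') \<le> \<eta> * sqrt (real k)))"
    proof (intro exI[of _ G] conjI allI impI)
      have "real (card G) \<le> real (card F0) * real (card M)"
        using G(3) G0(3) by (simp add: card_cartesian_product)
          (metis of_nat_mult of_nat_mono order_trans mult_le_mono1)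
      also have "\<dots> \<le> C0 ^ k\<^sup>2 * (exp 1 * (1 + 2 * L)) ^ k\<^sup>2"
        using F0 M C0 by (intro mult_mono) auto
      also have "\<dots> = (C0 * (exp 1 * (1 + 2 * L))) ^ k\<^sup>2" by (simp only: power_mult_distrib)
      also have "\<dots> \<le> (C / \<eta>) ^ k\<^sup>2"
      proof (rule power_mono)
        have "1 + 2 * L \<le> 7 / \<eta>" using \<eta> by (simp add: L_def field_simps)
        then have "C0 * (exp 1 * (1 + 2 * L)) \<le> C0 * (exp 1 * (7 / \<eta>))"
          using C0 by (intro mult_left_mono) auto
        then show "C0 * (exp 1 * (1 + 2 * L)) \<le> C / \<eta>" by (simp add: C_def)
        show "0 \<le> C0 * (exp 1 * (1 + 2 * L))" using C0 L by simp
      qed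
      finally show "real (card G) \<le> (C / \<eta>) ^ k\<^sup>2" .
      fix U assume U: "unitary_mat k U"
      then obtain U' l where l: "U' \<in> G" "l \<in> G0 \<times> M" "Q U l" "Q U' l" using G(4) by blast
      then have "hs (U - U') \<le> \<eta> * sqrt (real k)" using Q2 U G(1) by blast
      then show "\<exists>U'\<in>G. hs (U - U') \<le> \<eta> * sqrt (real k)" using l by blast
    qed (use G in auto)
  qed
qed

section \<open>From orbit covers to operator norm covers\<close>

lemma hs_conj_diff:
  assumes W: "unitary_mat k W" and "X \<in> carrier_mat k k" "Y \<in> carrier_mat k k"
  shows "hs (W * X * adj W - W * Y * adj W) = hs (X - Y)"
proof -
  note [simp] = mult_carrier_mat[of _ k k _ k] minus_carrier_mat[of _ k k]
    W[THEN unitary_carrier] W[THEN unitary_adj, THEN unitary_carrier] assms(2,3)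
  have "W * X * adj W - W * Y * adj W = (W * (X - Y)) * adj W"
    by (simp add: mult_minus_distrib_mat[of _ k k _ k] minus_mult_distrib_mat[of _ k k _ _ k])
  then show ?thesis using W by (simp add: hs_mult_unitary[of k _ _ k] hs_unitary_mult[of k _ _ k])
qed

text \<open>Telescoping through \<open>V * B * adj U\<close> gives two terms, each with a factor
  \<open>U - V\<close>. Self-adjointness lets the adjoint of the first term put \<open>B\<close> on
  the left, where its operator norm can be extracted.\<close>

lemma hs_conj_diff_unitary:
  assumes U: "unitary_mat k U" "unitary_mat k V" and B: "B \<in> sa_mats k"
  shows "hs (U * B * adj U - V * B * adj V) \<le> 2 * opnorm B * hs (U - V)"
proof -
  have Bc: "B \<in> carrier_mat k k" and Bs: "adj B = B" using B by (auto simp: sa_mats_def)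
  note [simp] = mult_carrier_mat[of _ k k _ k] minus_carrier_mat[of _ k k]
    U[THEN unitary_carrier] U[THEN unitary_adj, THEN unitary_carrier] Bc
  have "hs (U * B * adj U - V * B * adj V)
      \<le> hs (U * B * adj U - V * B * adj U) + hs (V * B * adj U - V * B * adj V)"
    by (rule hs_minus_le[of _ k k]) auto
  moreover have "U * B * adj U - V * B * adj U = ((U - V) * B) * adj U"
    by (simp add: minus_mult_distrib_mat[of _ k k _ _ k])
  moreover have "V * B * adj U - V * B * adj V = V * (B * adj (U - V))"
    by (simp add: adj_minus[of _ k k] mult_minus_distrib_mat[of _ k k _ k] assoc_mult_mat[of _ k k _ k _ k])
  ultimately have "hs (U * B * adj U - V * B * adj V) \<le> hs (((U - V) * B) * adj U) + hs (V * (B * adj (U - V)))"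
    by (simp only:)
  also have "hs (((U - V) * B) * adj U) = hs ((U - V) * B)"
    using U by (simp add: hs_mult_unitary[of k _ _ k])
  also have "hs ((U - V) * B) = hs (adj ((U - V) * B))" by simp
  also have "adj ((U - V) * B) = adj B * adj (U - V)" by (rule adj_mult[of _ k k _ k]) auto
  also have "adj B = B" by (fact Bs)
  also have "hs (V * (B * adj (U - V))) = hs (B * adj (U - V))"
    using U by (simp add: hs_unitary_mult[of k _ _ k])
  also have "hs (B * adj (U - V)) \<le> opnorm B * hs (U - V)"
    using hs_mult_le[of B k k "adj (U - V)" k] by simp
  finally show ?thesis by simp
qed

text \<open>The common centre \<open>C\<close> is eliminated: undoing \<open>V\<close> on
  \<open>B\<close> and then applying \<open>W\<close> lands near \<open>A\<close>, as conjugation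
  preserves \<open>hs\<close>.\<close>

lemma orbit_dist_trans:
  assumes W: "unitary_mat k W" "unitary_mat k V"
    and c: "A \<in> carrier_mat k k" "B \<in> carrier_mat k k" "C \<in> carrier_mat k k"
    and "hs (A - W * C * adj W) \<le> a" "hs (B - V * C * adj V) \<le> b"
  shows "hs (A - (W * adj V) * B * adj (W * adj V)) \<le> a + b"
proof -
  note [simp] = mult_carrier_mat[of _ k k _ k] minus_carrier_mat[of _ k k]
    W[THEN unitary_carrier] W[THEN unitary_adj, THEN unitary_carrier] c
  define B' where "B' = adj V * B * V"
  have [simp]: "B' \<in> carrier_mat k k" by (simp add: B'_def)
  have VV: "V * adj V = 1\<^sub>m k" using W by (simp add: unitary_mat_def)
  have 1: "(W * adj V) * B * adj (W * adj V) = W * B' * adj W"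
    by (simp add: adj_mult[of _ k k _ k] B'_def assoc_mult_mat[of _ k k _ k _ k])
  have "V * B' * adj V = (V * adj V) * B * (V * adj V)"
    by (simp add: B'_def assoc_mult_mat[of _ k k _ k _ k])
  then have 2: "V * B' * adj V = B" by (simp add: VV left_mult_one_mat[of _ k k] right_mult_one_mat[of _ k k])
  have "hs (W * C * adj W - W * B' * adj W) = hs (V * B' * adj V - V * C * adj V)"
    using W by (simp add: hs_conj_diff hs_minus_commute[of C k k])
  then have "hs (W * C * adj W - W * B' * adj W) \<le> b" using assms(7) by (simp only: 2)
  then show ?thesis
    using hs_minus_le[of A k k "W * C * adj W" "W * B' * adj W"] assms(6) by (simp add: 1)
qed

lemma tuple_norm2_less_component:
  assumes "set As \<subseteq> carrier_mat k k" "set Bs \<subseteq> carrier_mat k k" "length As = length Bs" and k: "k > 0"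
    and less: "tuple_norm2 k (tuple_diff As Bs) < w" and i: "i < length As"
  shows "hs (As ! i - Bs ! i) \<le> w * sqrt (real k)"
proof -
  let ?D = "tuple_diff As Bs"
  have D: "set ?D \<subseteq> carrier_mat k k" "length ?D = length As" "?D ! i = As ! i - Bs ! i"
    using assms by (auto simp: tuple_diff_def set_zip minus_carrier_mat subset_iff)
  have eq: "Re (sum_list (map (\<lambda>A. tau k (adj A * A)) Ds)) = (\<Sum>A\<leftarrow>Ds. (hs A)\<^sup>2 / real k)"
    if "set Ds \<subseteq> carrier_mat k k" for Ds
    using that by (induction Ds) (simp_all add: tau_adj_mult_self)
  have "(hs (?D ! i))\<^sup>2 / real k \<le> (\<Sum>j<length ?D. (hs (?D ! j))\<^sup>2 / real k)"
    using i D by (intro member_le_sum) auto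
  also have "\<dots> = (tuple_norm2 k ?D)\<^sup>2"
    unfolding tuple_norm2_def eq[OF D(1)]
    by (simp add: sum_list_sum_nth atLeast0LessThan sum_nonneg)
  also have "\<dots> \<le> w\<^sup>2"
    using less by (intro power_mono) (auto simp: tuple_norm2_def eq[OF D(1)] intro!: sum_list_nonneg)
  finally have "(hs (As ! i - Bs ! i))\<^sup>2 \<le> (w * sqrt (real k))\<^sup>2"
    using k D by (simp add: power_mult_distrib field_simps)
  moreover have "w > 0"
    using less by (rule le_less_trans[rotated]) (auto simp: tuple_norm2_def eq[OF D(1)] intro!: sum_list_nonneg)
  ultimately show ?thesis by (intro power2_le_imp_le[of "hs (As ! i - Bs ! i)"]) auto
qed

lemma tuple_norm_diff_less:
  assumes "length As = length Bs" "w > 0" "\<And>i. i < length As \<Longrightarrow> opnorm (As ! i - Bs ! i) < w"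
  shows "tuple_norm (tuple_diff As Bs) < w"
  unfolding tuple_norm_def using assms by (subst Max_less_iff) (auto simp: tuple_diff_def set_zip)

text \<open>The constant does not depend on the norms of the centres \<open>F\<close>, which are first replaced by points of \<open>S\<close>.\<close>

lemma op_cover_from_orbit_cover:
  fixes R :: real and n :: nat
  assumes R: "R \<ge> 0"
  shows "\<exists>C\<ge>1. \<forall>k>0. \<forall>w S F. 0 < w \<and> w \<le> 1 \<longrightarrow> finite F \<longrightarrow>
     S \<subseteq> {As. length As = n \<and> set As \<subseteq> sa_mats k \<and> (\<forall>A\<in>set As. opnorm A \<le> R)} \<longrightarrow>
     F \<subseteq> {Cs. length Cs = n \<and> set Cs \<subseteq> carrier_mat k k} \<longrightarrow>
     (\<forall>A\<in>S. \<exists>C\<in>F. \<exists>W. unitary_mat k W \<and> tuple_norm2 k (tuple_diff A (map (\<lambda>B. W * B * adj W) C)) < w) \<longrightarrow>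
     (\<exists>G\<subseteq>S. finite G \<and> real (card G) \<le> real (card F) * (C / w) ^ k\<^sup>2 \<and>
        (\<forall>A\<in>S. \<exists>B\<in>G. tuple_norm (tuple_diff A B) < w))"
proof -
  from unitary_cover obtain C1 where C1: "C1 \<ge> 1" and ucover: "\<forall>k>0. \<forall>\<eta>. 0 < \<eta> \<and> \<eta> \<le> 1 \<longrightarrow>
     (\<exists>F. F \<subseteq> Collect (unitary_mat k) \<and> finite F \<and> real (card F) \<le> (C1 / \<eta>) ^ k\<^sup>2 \<and>
     (\<forall>U. unitary_mat k U \<longrightarrow> (\<exists>U'\<in>F. hs (U - U') \<le> \<eta> * sqrt (real k))))"
    by (elim exE conjE)
  \<comment> \<open>Replacing \<open>U\<close> by the net element \<open>U'\<close> turns the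
    distance \<open>2 * w\<close> into at most \<open>2 * w + 2 * R * w\<close>, which is
    \<open>(6 + 6 * R) * (w / 3)\<close>; the operator norm cover is used at
    \<open>t = w / 3\<close>.\<close>
  have "6 + 6 * R \<ge> 0" using R by simp
  from opnorm_cover[OF this] obtain C2 where C2: "C2 \<ge> 1" and
    ocover: "\<And>k t. k > 0 \<Longrightarrow> t > 0 \<Longrightarrow> \<exists>F. F \<subseteq> carrier_mat k k \<and> finite F \<and> real (card F) \<le> C2 ^ k\<^sup>2 \<and>
     (\<forall>A\<in>carrier_mat k k. hs A \<le> (6 + 6 * R) * t * sqrt (real k) \<longrightarrow> (\<exists>B\<in>F. opnorm (A - B) \<le> t))"
    by auto
  define C where "C = C1 * C2 ^ n"
  have "1 * 1 \<le> C1 * C2 ^ n" using C1 C2 by (intro mult_mono one_le_power) auto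
  then have C: "C \<ge> 1" by (simp add: C_def)
  show ?thesis
  proof (intro exI[of _ C] conjI C allI impI)
    fix k :: nat and w :: real and S F :: "complex mat list set"
    assume k: "k > 0" and w: "0 < w \<and> w \<le> 1" and finF: "finite F"
      and S: "S \<subseteq> {As. length As = n \<and> set As \<subseteq> sa_mats k \<and> (\<forall>A\<in>set As. opnorm A \<le> R)}"
      and F: "F \<subseteq> {Cs. length Cs = n \<and> set Cs \<subseteq> carrier_mat k k}"
      and cov: "\<forall>A\<in>S. \<exists>C\<in>F. \<exists>W. unitary_mat k W \<and> tuple_norm2 k (tuple_diff A (map (\<lambda>B. W * B * adj W) C)) < w"
    note [simp] = mult_carrier_mat[of _ k k _ k] minus_carrier_mat[of _ k k]
    have Sn: "length A = n" "i < n \<Longrightarrow> A ! i \<in> carrier_mat k k" "i < n \<Longrightarrow> A ! i \<in> sa_mats k"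
      "i < n \<Longrightarrow> opnorm (A ! i) \<le> R" if "A \<in> S" for A i
      using that S by (auto simp: sa_mats_def subset_iff)
    define RF where "RF A Cs \<longleftrightarrow> (\<exists>W. unitary_mat k W \<and>
      (\<forall>i<n. hs (A ! i - W * Cs ! i * adj W) \<le> w * sqrt (real k)))" for A Cs
    have "\<forall>A\<in>S. \<exists>C\<in>F. RF A C"
    proof
      fix A assume A: "A \<in> S"
      then obtain Cs W where CW: "Cs \<in> F" "unitary_mat k W"
        "tuple_norm2 k (tuple_diff A (map (\<lambda>B. W * B * adj W) Cs)) < w" using cov by blast
      have lC: "length Cs = n" "set Cs \<subseteq> carrier_mat k k" using CW F by auto
      have "hs (A ! i - W * Cs ! i * adj W) \<le> w * sqrt (real k)" if i: "i < n" for i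
      proof -
        have "hs (A ! i - map (\<lambda>B. W * B * adj W) Cs ! i) \<le> w * sqrt (real k)"
          using A Sn(1) S lC CW k i
          by (intro tuple_norm2_less_component) (auto simp: sa_mats_def subset_iff)
        then show ?thesis using i lC by simp
      qed
      then show "\<exists>C\<in>F. RF A C" using CW unfolding RF_def by blast
    qed
    from recenter_cover[OF finF this] obtain G0 where G0: "G0 \<subseteq> S" "finite G0" "card G0 \<le> card F"
      "\<forall>A\<in>S. \<exists>A0\<in>G0. \<exists>Cs\<in>F. RF A Cs \<and> RF A0 Cs" by blast
    \<comment> \<open>\<open>A\<close> and \<open>A0\<close> are both within \<open>w\<close> of the
      orbit of one centre, hence the radius \<open>2 * w\<close>.\<close>
    have orb: "\<exists>A0\<in>G0. \<exists>U. unitary_mat k U \<and>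
       (\<forall>i<n. hs (A ! i - U * A0 ! i * adj U) \<le> 2 * w * sqrt (real k))" if A: "A \<in> S" for A
    proof -
      obtain A0 Cs W V where *: "A0 \<in> G0" "Cs \<in> F" "unitary_mat k W" "unitary_mat k V"
        "\<forall>i<n. hs (A ! i - W * Cs ! i * adj W) \<le> w * sqrt (real k)"
        "\<forall>i<n. hs (A0 ! i - V * Cs ! i * adj V) \<le> w * sqrt (real k)"
        using G0(4) A unfolding RF_def by blast
      have "A0 \<in> S" using * G0 by blast
      have "hs (A ! i - (W * adj V) * A0 ! i * adj (W * adj V)) \<le> w * sqrt (real k) + w * sqrt (real k)"
        if i: "i < n" for i
      proof (rule orbit_dist_trans[OF *(3,4)])
        show "Cs ! i \<in> carrier_mat k k" using subsetD[OF F *(2)] i by (auto simp: subset_iff)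
      qed (use * i Sn A \<open>A0 \<in> S\<close> in auto)
      then show ?thesis using * by (intro bexI[of _ A0] exI[of _ "W * adj V"]) (auto simp: mult.assoc)
    qed
    obtain FU where FU: "FU \<subseteq> Collect (unitary_mat k)" "finite FU" "real (card FU) \<le> (C1 / w) ^ k\<^sup>2"
      "\<And>U. unitary_mat k U \<Longrightarrow> \<exists>U'\<in>FU. hs (U - U') \<le> w * sqrt (real k)"
      using ucover[rule_format, OF k w] by blast
    obtain FO where FO: "FO \<subseteq> carrier_mat k k" "finite FO" "real (card FO) \<le> C2 ^ k\<^sup>2"
      "\<And>A. A \<in> carrier_mat k k \<Longrightarrow> hs A \<le> (6 + 6 * R) * (w / 3) * sqrt (real k) \<Longrightarrow> \<exists>B\<in>FO. opnorm (A - B) \<le> w / 3"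
      using ocover[OF k, of "w / 3"] w by auto
    \<comment> \<open>A label consists of an orbit representative, a conjugating unitary and an
      operator norm approximation to each of the \<open>n\<close> remaining differences. Tuples
      sharing a label are within \<open>2 * w / 3\<close>, so the strict bound by \<open>w\<close>
      survives.\<close>
    define Lb where "Lb = G0 \<times> FU \<times> {Bs. set Bs \<subseteq> FO \<and> length Bs = n}"
    define Q where "Q A = (\<lambda>(A0, U, Bs). \<forall>i<n. opnorm (A ! i - U * A0 ! i * adj U - Bs ! i) \<le> w / 3)"
      for A :: "complex mat list"
    have finL: "finite Lb" using G0 FU FO by (simp add: Lb_def finite_lists_length_eq)
    have "\<forall>A\<in>S. \<exists>l\<in>Lb. Q A l"
    proof
      fix A assume A: "A \<in> S"
      then obtain A0 U where A0: "A0 \<in> G0" and U: "unitary_mat k U"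
        "\<And>i. i < n \<Longrightarrow> hs (A ! i - U * A0 ! i * adj U) \<le> 2 * w * sqrt (real k)" using orb by blast
      have A0S: "A0 \<in> S" using A0 G0 by blast
      obtain U' where U': "U' \<in> FU" "hs (U - U') \<le> w * sqrt (real k)" using FU(4)[OF U(1)] by blast
      have uU': "unitary_mat k U'" using U' FU by blast
      note [simp] = U(1)[THEN unitary_carrier] U(1)[THEN unitary_adj, THEN unitary_carrier]
        uU'[THEN unitary_carrier] uU'[THEN unitary_adj, THEN unitary_carrier]
      have "\<exists>B\<in>FO. opnorm (A ! i - U' * A0 ! i * adj U' - B) \<le> w / 3" if i: "i < n" for i
      proof (rule FO(4))
        have c[simp]: "A ! i \<in> carrier_mat k k" "A0 ! i \<in> carrier_mat k k" using Sn A A0S i by auto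
        show "A ! i - U' * A0 ! i * adj U' \<in> carrier_mat k k" by simp
        have "hs (A ! i - U' * A0 ! i * adj U') \<le> hs (A ! i - U * A0 ! i * adj U)
            + hs (U * A0 ! i * adj U - U' * A0 ! i * adj U')"
          by (rule hs_minus_le[of _ k k]) auto
        also have "hs (U * A0 ! i * adj U - U' * A0 ! i * adj U') \<le> 2 * opnorm (A0 ! i) * hs (U - U')"
          using U uU' Sn(3)[OF A0S i] by (intro hs_conj_diff_unitary) auto
        also have "2 * opnorm (A0 ! i) * hs (U - U') \<le> 2 * R * (w * sqrt (real k))"
          using Sn(4)[OF A0S i] U'(2) R by (intro mult_mono) auto
        also have "hs (A ! i - U * A0 ! i * adj U) \<le> 2 * w * sqrt (real k)" using U i by simp
        finally show "hs (A ! i - U' * A0 ! i * adj U') \<le> (6 + 6 * R) * (w / 3) * sqrt (real k)"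
          by (simp add: algebra_simps)
      qed
      then obtain b where b: "\<And>i. i < n \<Longrightarrow> b i \<in> FO \<and> opnorm (A ! i - U' * A0 ! i * adj U' - b i) \<le> w / 3"
        by metis
      then have "Q A (A0, U', map b [0..<n])" by (auto simp: Q_def)
      moreover have "(A0, U', map b [0..<n]) \<in> Lb" using b A0 U' by (auto simp: Lb_def)
      ultimately show "\<exists>l\<in>Lb. Q A l" by blast
    qed
    from recenter_cover[OF finL this] obtain G where G: "G \<subseteq> S" "finite G" "card G \<le> card Lb"
      "\<forall>A\<in>S. \<exists>B\<in>G. \<exists>l\<in>Lb. Q A l \<and> Q B l" by blast
    show "\<exists>G\<subseteq>S. finite G \<and> real (card G) \<le> real (card F) * (C / w) ^ k\<^sup>2 \<and>
        (\<forall>A\<in>S. \<exists>B\<in>G. tuple_norm (tuple_diff A B) < w)"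
    proof (intro exI[of _ G] conjI ballI G)
      have "real (card G) \<le> real (card G0) * (real (card FU) * real (card FO) ^ n)"
        using G(3) FO(2) by (simp add: Lb_def card_cartesian_product card_lists_length_eq flip: of_nat_mult of_nat_power)
      also have "\<dots> \<le> real (card F) * ((C1 / w) ^ k\<^sup>2 * (C2 ^ k\<^sup>2) ^ n)"
        using G0 FU FO C1 w by (intro mult_mono power_mono) auto
      also have "(C1 / w) ^ k\<^sup>2 * (C2 ^ k\<^sup>2) ^ n = (C / w) ^ k\<^sup>2"
        by (simp add: C_def power_mult_distrib power_divide power_mult[symmetric] mult.commute)
      finally show "real (card G) \<le> real (card F) * (C / w) ^ k\<^sup>2" .
      fix A assume A: "A \<in> S"
      then obtain B l where Bl: "B \<in> G" "l \<in> Lb" "Q A l" "Q B l" using G by blast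
      obtain A0 U Bs where l: "l = (A0, U, Bs)" "A0 \<in> S" "unitary_mat k U" "set Bs \<subseteq> carrier_mat k k" "length Bs = n"
      proof -
        obtain A0 U Bs where "l = (A0, U, Bs)" "A0 \<in> G0" "U \<in> FU" "set Bs \<subseteq> FO" "length Bs = n"
          using Bl(2) by (auto simp: Lb_def)
        then show thesis using that FU(1) FO(1) G0(1) by blast
      qed
      have BS: "B \<in> S" using Bl G by blast
      have "tuple_norm (tuple_diff A B) < w"
      proof (rule tuple_norm_diff_less)
        fix i assume "i < length A"
        then have i: "i < n" using Sn A by simp
        define X where "X = U * A0 ! i * adj U"
        have c: "X \<in> carrier_mat k k" "A ! i \<in> carrier_mat k k" "B ! i \<in> carrier_mat k k" "Bs ! i \<in> carrier_mat k k"
          using l i Sn A BS by (auto simp: X_def)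
        have "A ! i - B ! i = (A ! i - X) - (B ! i - X)" using c by (intro eq_matI) auto
        then have "opnorm (A ! i - B ! i) \<le> opnorm ((A ! i - X) - Bs ! i) + opnorm (Bs ! i - (B ! i - X))"
          using opnorm_minus_le[of "A ! i - X" k k "Bs ! i" "B ! i - X"] c by simp
        also have "opnorm (Bs ! i - (B ! i - X)) = opnorm ((B ! i - X) - Bs ! i)"
          using c by (intro opnorm_minus_commute[of _ k k]) auto
        also have "opnorm ((A ! i - X) - Bs ! i) + opnorm ((B ! i - X) - Bs ! i) \<le> w / 3 + w / 3"
          using Bl i by (intro add_mono) (auto simp: Q_def l X_def)
        finally show "opnorm (A ! i - B ! i) < w" using w by simp
      qed (use Sn A BS w in auto)
      then show "\<exists>B\<in>G. tuple_norm (tuple_diff A B) < w" using Bl by blast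
    qed
  qed
qed

section \<open>Entropy dimension\<close>

lemma enat_Inf_attained:
  fixes A :: "enat set"
  assumes "Inf A \<noteq> \<infinity>"
  shows "Inf A \<in> A"
proof -
  have "A \<noteq> {}" using assms by (auto simp: Inf_enat_def)
  then show ?thesis unfolding Inf_enat_def by (auto intro: LeastI)
qed

text \<open>Comparing with \<open>exp x\<close> instead of taking a logarithm of \<open>m\<close>
  accommodates the empty cover, where \<open>elog\<close> is \<open>-\<infinity>\<close>.\<close>

lemma elog_le:
  assumes "N \<le> enat m" "real m \<le> exp x"
  shows "elog N \<le> ereal x"
proof -
  obtain n where n: "N = enat n" "n \<le> m" using assms(1) by (cases N) auto
  show ?thesis
  proof (cases "n = 0")
    case False
    have "ln (real n) \<le> ln (exp x)" using False n assms(2) by (subst ln_le_cancel_iff) auto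
    then show ?thesis using False n by (simp add: elog_def enat_0_iff)
  qed (simp add: n elog_def enat_0_iff)
qed

lemma elog_leD:
  assumes "elog N \<le> ereal x"
  shows "\<exists>m. N = enat m \<and> real m \<le> exp x"
proof (cases N)
  case (enat m)
  have "real m \<le> exp x"
  proof (cases "m = 0")
    case False
    then have "ln (real m) \<le> x" using assms enat by (simp add: elog_def enat_0_iff)
    then have "exp (ln (real m)) \<le> exp x" by simp
    then show ?thesis using False by simp
  qed simp
  then show ?thesis using enat by simp
qed (use assms in \<open>simp add: elog_def\<close>)

lemma nu_inf_le:
  assumes "finite G" "G \<subseteq> S" "\<forall>A\<in>S. \<exists>B\<in>G. tuple_norm (tuple_diff A B) < w"
  shows "nu_inf S w \<le> enat (card G)"
  unfolding nu_inf_def using assms by (intro Inf_lower) blast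

lemma o2_attained:
  assumes "o2 k S w = enat m"
  shows "\<exists>F\<subseteq>S. finite F \<and> card F = m \<and> (\<forall>A\<in>S. \<exists>C\<in>F. \<exists>W. unitary_mat k W \<and>
          tuple_norm2 k (tuple_diff A (map (\<lambda>B. W * B * adj W) C)) < w)"
proof -
  have "o2 k S w \<noteq> \<infinity>" using assms by simp
  from enat_Inf_attained[OF this[unfolded o2_def]]
  have "enat m \<in> {enat (card F) | F. finite F \<and> F \<subseteq> S \<and>
      (\<forall>A\<in>S. \<exists>C\<in>F. \<exists>W. unitary_mat k W \<and>
          tuple_norm2 k (tuple_diff A (map (\<lambda>B. W * B * adj W) C)) < w)}"
    unfolding o2_def[symmetric] assms .
  then show ?thesis by blast
qed

text \<open>This allows parameters that witness an orbit bound to be tightened until the uniform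
  norm bound applies.\<close>

lemma Gamma_top_mono:
  assumes "\<epsilon>' \<le> \<epsilon>" "r \<le> r'"
  shows "Gamma_top sc P xs ys R k \<epsilon>' r' \<subseteq> Gamma_top sc P xs ys R k \<epsilon> r"
proof
  fix As assume "As \<in> Gamma_top sc P xs ys R k \<epsilon>' r'"
  then obtain Bs where A: "length As = length xs" "set As \<subseteq> sa_mats k"
    and B: "length Bs = length ys" "set Bs \<subseteq> sa_mats k" "\<forall>A\<in>set (As @ Bs). opnorm A \<le> R"
    and P: "\<forall>j\<in>{1..r'}. \<bar>opnorm (eval_mat k (As @ Bs) (P j)) - norm (eval_alg sc (xs @ ys) (P j))\<bar> \<le> \<epsilon>'"
    unfolding Gamma_top_def by blast
  have "\<forall>j\<in>{1..r}. \<bar>opnorm (eval_mat k (As @ Bs) (P j)) - norm (eval_alg sc (xs @ ys) (P j))\<bar> \<le> \<epsilon>"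
  proof
    fix j assume "j \<in> {1..r}"
    then have "j \<in> {1..r'}" using assms by auto
    then show "\<bar>opnorm (eval_mat k (As @ Bs) (P j)) - norm (eval_alg sc (xs @ ys) (P j))\<bar> \<le> \<epsilon>"
      using P assms(1) by (meson order_trans)
  qed
  then show "As \<in> Gamma_top sc P xs ys R k \<epsilon> r" using A B unfolding Gamma_top_def by blast
qed

lemma Gamma_top_norm_bound:
  fixes xs :: "'a :: real_normed_algebra_1 list"
  assumes P: "{p. pvars p \<subseteq> {..<length xs}} \<subseteq> P ` {1..}"
  shows "\<exists>R0\<ge>0. \<exists>r0\<ge>1. \<forall>R k \<epsilon> r. \<epsilon> \<le> 1 \<longrightarrow> r0 \<le> r \<longrightarrow>
    (\<forall>As\<in>Gamma_top sc P xs [] R k \<epsilon> r. \<forall>A\<in>set As. opnorm A \<le> R0)"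
proof -
  define R0 where "R0 = 1 + Max (insert 0 (norm ` set xs))"
  have R0: "norm x + 1 \<le> R0" if "x \<in> set xs" for x
    using that by (simp add: R0_def)
  have "0 \<le> Max (insert 0 (norm ` set xs))" by (rule Max_ge) auto
  then have R0p: "R0 \<ge> 0" by (simp add: R0_def)
  have "\<forall>i. \<exists>j. i < length xs \<longrightarrow> j \<ge> 1 \<and> P j = PVar i"
  proof (intro allI)
    fix i show "\<exists>j. i < length xs \<longrightarrow> j \<ge> 1 \<and> P j = PVar i"
    proof (cases "i < length xs")
      case True
      then have "PVar i \<in> P ` {1..}" by (intro subsetD[OF P]) auto
      then obtain j where "j \<ge> 1" "PVar i = P j" by auto
      then show ?thesis by (intro exI[of _ j]) auto
    qed auto
  qed
  then obtain j where j: "\<And>i. i < length xs \<Longrightarrow> j i \<ge> 1 \<and> P (j i) = PVar i" by metis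
  \<comment> \<open>Finitely many indices occur, so one \<open>r0\<close> reaches every coordinate
    polynomial; the inserted \<open>1\<close> covers the empty tuple.\<close>
  define r0 where "r0 = Max (insert 1 (j ` {..<length xs}))"
  have r0: "j i \<le> r0" if "i < length xs" for i unfolding r0_def using that by (intro Max_ge) auto
  have r01: "1 \<le> r0" unfolding r0_def by (intro Max_ge) auto
  show ?thesis
  proof (intro exI[of _ R0] exI[of _ r0] conjI R0p r01 allI impI ballI)
    fix R k \<epsilon> r As A
    assume e: "\<epsilon> \<le> 1" and r: "r0 \<le> r" and As: "As \<in> Gamma_top sc P xs [] R k \<epsilon> r" and A: "A \<in> set As"
    from As have lA: "length As = length xs"
      and *: "\<forall>j\<in>{1..r}. \<bar>opnorm (eval_mat k As (P j)) - norm (eval_alg sc xs (P j))\<bar> \<le> \<epsilon>"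
      by (auto simp: Gamma_top_def)
    obtain i where i: "i < length xs" "A = As ! i" using A lA by (metis in_set_conv_nth)
    have "j i \<in> {1..r}" using j[OF i(1)] r0[OF i(1)] r by auto
    then have "\<bar>opnorm (eval_mat k As (P (j i))) - norm (eval_alg sc xs (P (j i)))\<bar> \<le> \<epsilon>" using * by blast
    then have "\<bar>opnorm A - norm (xs ! i)\<bar> \<le> \<epsilon>" using j[OF i(1)] i(2) by simp
    moreover have "norm (xs ! i) + 1 \<le> R0" using i by (intro R0) auto
    ultimately show "opnorm A \<le> R0" using e by linarith
  qed
qed

text \<open>Any finite bound \<open>B\<close> for the orbit dimension will do, because it enters
  only through \<open>(B + ln C) / (- ln w)\<close>. As \<open>C\<close> depends on
  \<open>R0\<close> and not on the cut-off \<open>R\<close>, the supremum over \<open>R\<close> does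
  no harm.\<close>

lemma delta_top_le_1:
  fixes sc :: "complex \<Rightarrow> 'a::real_normed_algebra_1 \<Rightarrow> 'a" and xs :: "'a list"
  assumes P: "{p. pvars p \<subseteq> {..<length xs}} \<subseteq> P ` {1..}"
    and fin: "orbit_dim sc P xs [] \<noteq> \<infinity>"
  shows "delta_top sc P xs [] \<le> 1"
proof -
  from Gamma_top_norm_bound[OF P, of sc] obtain R0 r0 where R0: "R0 \<ge> 0" and r0: "r0 \<ge> 1" and
    norm_bound: "\<And>R k \<epsilon> r As A. \<epsilon> \<le> 1 \<Longrightarrow> r0 \<le> r \<Longrightarrow> As \<in> Gamma_top sc P xs [] R k \<epsilon> r
       \<Longrightarrow> A \<in> set As \<Longrightarrow> opnorm A \<le> R0"
    by blast
  from op_cover_from_orbit_cover[OF R0, of "length xs"] obtain C where C: "C \<ge> 1" and cover: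
    "\<forall>k>0. \<forall>w S F. 0 < w \<and> w \<le> 1 \<longrightarrow> finite F \<longrightarrow>
     S \<subseteq> {As. length As = length xs \<and> set As \<subseteq> sa_mats k \<and> (\<forall>A\<in>set As. opnorm A \<le> R0)} \<longrightarrow>
     F \<subseteq> {Cs. length Cs = length xs \<and> set Cs \<subseteq> carrier_mat k k} \<longrightarrow>
     (\<forall>A\<in>S. \<exists>C\<in>F. \<exists>W. unitary_mat k W \<and> tuple_norm2 k (tuple_diff A (map (\<lambda>B. W * B * adj W) C)) < w) \<longrightarrow>
     (\<exists>G\<subseteq>S. finite G \<and> real (card G) \<le> real (card F) * (C / w) ^ k\<^sup>2 \<and>
        (\<forall>A\<in>S. \<exists>B\<in>G. tuple_norm (tuple_diff A B) < w))"
    by (elim exE conjE)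
  obtain N :: nat where "orbit_dim sc P xs [] < ereal (real N)"
    using fin by (auto simp: less_PInf_Ex_of_nat)
  define B where "B = real N"
  have ev: "\<forall>\<^sub>F w in at_right (0::real). orbit_dim_omega sc P xs [] w < ereal B"
    using \<open>orbit_dim sc P xs [] < ereal (real N)\<close> unfolding orbit_dim_def B_def by (rule Limsup_lessD)
  have "\<forall>\<^sub>F w in at_right (0::real). w \<in> {0<..<1}"
    by (rule eventually_at_right_real) simp
  with ev have "\<forall>\<^sub>F w in at_right (0::real). (SUP R\<in>{0<..}. INF \<epsilon>r\<in>{0<..} \<times> {1..}.
         limsup (\<lambda>k. elog (nu_inf (Gamma_top sc P xs [] R k (fst \<epsilon>r) (snd \<epsilon>r)) w)
                      / ereal (- (real k)\<^sup>2 * ln w))) \<le> ereal (1 + (B + ln C) / (- ln w))"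
  proof eventually_elim
    case (elim w)
    then have w: "0 < w" "w < 1" by auto
    then have lnw: "ln w < 0" by simp
    show ?case
    proof (rule SUP_least)
      fix R :: real assume R: "R \<in> {0<..}"
      have "(INF \<epsilon>r\<in>{0<..} \<times> {1..}. limsup (\<lambda>k. elog (o2 k (Gamma_top sc P xs [] R k (fst \<epsilon>r) (snd \<epsilon>r)) w)
              / ereal ((real k)\<^sup>2))) \<le> orbit_dim_omega sc P xs [] w"
        unfolding orbit_dim_omega_def using R by (intro SUP_upper) auto
      also have "\<dots> < ereal B" by fact
      finally obtain \<epsilon> r where er: "\<epsilon> > 0" "r \<ge> 1" and
        lim: "limsup (\<lambda>k. elog (o2 k (Gamma_top sc P xs [] R k \<epsilon> r) w) / ereal ((real k)\<^sup>2)) < ereal B"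
        by (auto simp: INF_less_iff)
      define \<epsilon>' where "\<epsilon>' = min \<epsilon> 1"
      define r' where "r' = max r r0"
      have "\<forall>\<^sub>F k in sequentially. elog (o2 k (Gamma_top sc P xs [] R k \<epsilon> r) w) / ereal ((real k)\<^sup>2) < ereal B"
        using lim by (rule Limsup_lessD)
      moreover have "\<forall>\<^sub>F k in sequentially. k > (0::nat)" by (rule eventually_gt_at_top)
      ultimately have "\<forall>\<^sub>F k in sequentially. elog (nu_inf (Gamma_top sc P xs [] R k \<epsilon>' r') w)
          / ereal (- (real k)\<^sup>2 * ln w) \<le> ereal (1 + (B + ln C) / (- ln w))"
      proof eventually_elim
        case (elim k)
        let ?S = "Gamma_top sc P xs [] R k \<epsilon> r" and ?S' = "Gamma_top sc P xs [] R k \<epsilon>' r'"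
        have SS: "?S' \<subseteq> ?S" by (rule Gamma_top_mono) (auto simp: \<epsilon>'_def r'_def)
        have "elog (o2 k ?S w) < ereal B * ereal ((real k)\<^sup>2)"
          using elim by (subst (asm) ereal_divide_less_iff) auto
        then have "elog (o2 k ?S w) \<le> ereal (B * (real k)\<^sup>2)" by simp
        then obtain m where m: "o2 k ?S w = enat m" "real m \<le> exp (B * (real k)\<^sup>2)"
          using elog_leD by blast
        \<comment> \<open>\<open>F\<close> belongs to the looser parameters: its points may lie
          outside \<open>?S'\<close> and exceed the norm bound \<open>R0\<close>, which
          \<open>cover\<close> tolerates.\<close>
        from o2_attained[OF m(1)] obtain F where F: "F \<subseteq> ?S" "finite F" "card F = m"
          "\<forall>A\<in>?S. \<exists>C\<in>F. \<exists>W. unitary_mat k W \<and>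
            tuple_norm2 k (tuple_diff A (map (\<lambda>B. W * B * adj W) C)) < w" by blast
        have "\<exists>G\<subseteq>?S'. finite G \<and> real (card G) \<le> real (card F) * (C / w) ^ k\<^sup>2 \<and>
          (\<forall>A\<in>?S'. \<exists>B\<in>G. tuple_norm (tuple_diff A B) < w)"
        proof (rule cover[rule_format])
          show "k > 0" by fact
          show "0 < w \<and> w \<le> 1" using w by simp
          show "finite F" by fact
          show "?S' \<subseteq> {As. length As = length xs \<and> set As \<subseteq> sa_mats k \<and> (\<forall>A\<in>set As. opnorm A \<le> R0)}"
            using norm_bound[of \<epsilon>' r'] by (auto simp: \<epsilon>'_def r'_def Gamma_top_def)
          show "F \<subseteq> {Cs. length Cs = length xs \<and> set Cs \<subseteq> carrier_mat k k}"
            using F(1) by (auto simp: Gamma_top_def sa_mats_def)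
          show "\<exists>C\<in>F. \<exists>W. unitary_mat k W \<and> tuple_norm2 k (tuple_diff A (map (\<lambda>B. W * B * adj W) C)) < w"
            if "A \<in> ?S'" for A using F(4) that SS by blast
        qed
        then obtain G where G: "G \<subseteq> ?S'" "finite G" "real (card G) \<le> real (card F) * (C / w) ^ k\<^sup>2"
          "\<forall>A\<in>?S'. \<exists>B\<in>G. tuple_norm (tuple_diff A B) < w" by blast
        have "(C / w) ^ k\<^sup>2 = exp ((ln C - ln w) * (real k)\<^sup>2)"
        proof -
          have "C / w = exp (ln C - ln w)" using C w by (simp add: exp_diff)
          then show ?thesis by (simp add: exp_of_nat2_mult[symmetric])
        qed
        then have "real (card G) \<le> exp (B * (real k)\<^sup>2) * exp ((ln C - ln w) * (real k)\<^sup>2)"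
          using G(3) F(3) m(2) by (simp add: order_trans[OF _ mult_right_mono])
        then have "real (card G) \<le> exp ((B + ln C - ln w) * (real k)\<^sup>2)"
          by (simp add: exp_add[symmetric] algebra_simps)
        from elog_le[OF nu_inf_le[OF G(2,1,4)] this]
        have "elog (nu_inf ?S' w) / ereal (- (real k)\<^sup>2 * ln w)
            \<le> ereal ((B + ln C - ln w) * (real k)\<^sup>2) / ereal (- (real k)\<^sup>2 * ln w)"
          using lnw elim by (intro ereal_divide_right_mono) (auto simp: mult_pos_neg)
        also have "\<dots> = ereal ((B + ln C - ln w) * (real k)\<^sup>2 / (- (real k)\<^sup>2 * ln w))"
          using lnw elim by simp
        \<comment> \<open>The \<open>1\<close> is the share of the unitary net, whose cardinality
          carries the only power of \<open>1 / w\<close>.\<close>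
        also have "(B + ln C - ln w) * (real k)\<^sup>2 / (- (real k)\<^sup>2 * ln w) = 1 + (B + ln C) / (- ln w)"
          using lnw elim by (simp add: field_simps)
        finally show ?case .
      qed
      then have "limsup (\<lambda>k. elog (nu_inf (Gamma_top sc P xs [] R k \<epsilon>' r') w)
          / ereal (- (real k)\<^sup>2 * ln w)) \<le> ereal (1 + (B + ln C) / (- ln w))"
        by (rule Limsup_bounded)
      moreover have "(\<epsilon>', r') \<in> {0<..} \<times> {1..}" using er by (auto simp: \<epsilon>'_def r'_def)
      ultimately show "(INF \<epsilon>r\<in>{0<..} \<times> {1..}.
         limsup (\<lambda>k. elog (nu_inf (Gamma_top sc P xs [] R k (fst \<epsilon>r) (snd \<epsilon>r)) w)
                      / ereal (- (real k)\<^sup>2 * ln w))) \<le> ereal (1 + (B + ln C) / (- ln w))"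
        by (intro INF_lower2[of "(\<epsilon>', r')"]) auto
    qed
  qed
  then have "delta_top sc P xs [] \<le> Limsup (at_right 0) (\<lambda>w. ereal (1 + (B + ln C) / (- ln w)))"
    unfolding delta_top_def by (rule Limsup_mono)
  also have "\<dots> = ereal 1"
  proof (rule lim_imp_Limsup)
    have "filterlim (\<lambda>w::real. - ln w) at_top (at_right 0)"
      using ln_at_0 by (simp add: filterlim_uminus_at_top)
    then have "((\<lambda>w. (B + ln C) / (- ln w)) \<longlongrightarrow> 0) (at_right 0)"
      by (intro tendsto_divide_0[OF tendsto_const] filterlim_at_top_imp_at_infinity)
    from tendsto_add[OF tendsto_const[of 1] this]
    show "((\<lambda>w. ereal (1 + (B + ln C) / (- ln w))) \<longlongrightarrow> ereal 1) (at_right 0)"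
      by (intro tendsto_ereal) simp
  qed simp
  finally show ?thesis by (simp add: one_ereal_def)
qed

theorem theorem3p1:
  fixes sc :: "complex \<Rightarrow> 'a::{real_normed_algebra_1,banach} \<Rightarrow> 'a"
    and st :: "'a \<Rightarrow> 'a"
    and xs :: "'a list"
    and P :: "nat \<Rightarrow> ncpoly"
  assumes "unital_cstar sc st"
    and "\<forall>x\<in>set xs. st x = x"
    and "P ` {1..} = {p. pvars p \<subseteq> {..<length xs}}"
  shows "delta_top sc P xs [] \<le> max (orbit_dim sc P xs []) 1 \<and>
         (orbit_dim sc P xs [] = 0 \<longrightarrow> delta_top sc P xs [] \<le> 1)"
proof (cases "orbit_dim sc P xs [] = \<infinity>")
  case False
  then have "delta_top sc P xs [] \<le> 1"
    using assms(3) by (intro delta_top_le_1) auto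
  then show ?thesis by (auto simp: le_max_iff_disj)
\<comment> \<open>If the orbit dimension is infinite, so is the maximum, and the premise of the
  implication fails.\<close>
qed simp

end
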